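(* Let $f(x,\dot x,t)=0$ be an analytic $\sigma\pi$-ODE in implicit form, where $f:U\subset\mathbb R^{2n+1}\to\mathbb R^n$ ($U$ open) has full rank $n$ with respect to the $\dot x$ indeterminates (i.e. the Jacobian $\partial_{\dot x}f$ has rank $n$) at a point $z=(x,\dot x,t)\in\mathcal U$, where $\mathcal U=\{(x,\dot x,t)\in U: f(x,\dot x,t)=0\}$. Then the associated explicit local representation $\dot x=\phi(x,t)$ is $\sigma\pi$-reducible.
   Context: **Implicit $\sigma\pi$-ODE.** $f$ is an analytic $\sigma\pi$-function in the $2n$ indeterminates $(x,\dot x)$: each component is a finite sum $f_i(x,\dot x,t)=\sum_{l}v_{i,l}(t)\prod_{j=1}^n x_j^{p^l_{i,j}}\,\dot x_j^{\,q^l_{i,j}}$ with arbitrary real exponents $p^l_{i,j},q^l_{i,j}$ and coefficients $v_{i,l}$ real analytic on an open interval $\mathcal T$, and $f$ is real analytic on the open set $U$. Here $x\in\mathbb R^n$ and $\dot x\in\mathbb R^n$ are treated as independent variables of $f$. **Explicit local representation.** By the implicit function (Dini) theorem there are open sets $U_1\subset U$ containing $z=(x,\dot x,t)$ and $U_2\subset\mathbb R^{n+1}$ containing $(x,t)$, and a (real analytic) function $\phi:U_2\to\mathbb R^n$ such that $\mathcal U\cap U_1=\{(x,\phi(x,t),t):(x,t)\in U_2\}$, the matrix $(\partial_{\dot x}f)(x,\phi(x,t),t)$ is invertible for $(x,t)\in U_2$, and, with $y=(x,t)$, $(\partial_y\phi)(x,t)=-\big((\partial_{\dot x}f)(x,\phi(x,t),t)\big)^{-1}(\partial_yf)(x,\phi(x,t),t)$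 on $U_2$. The explicit local representation is the ODE $\dot x=\phi(x,t)$ on the domain $U_2$. **$\sigma\pi$-reducible.** The ODE $\dot x=\phi(x,t)$ with domain $U_2\subset\mathbb R^{n+1}$ is $\sigma\pi$-reducible if there are an integer $d\ge0$, additional indeterminates $x_{n+1},\dots,x_{n+d}$, and a $\sigma\pi$-ODE $\dot x_i=\sum_{l=1}^{\nu_i}v_{i,l}(t)\prod_{j=1}^{n+d}x_j^{p^l_{i,j}}$, $i=1,\dots,n+d$, with real exponents and analytic coefficients $v_{i,l}$, such that every solution of $\dot x=\phi(x,t)$ passing through a point of $U_2$ is a local sub-solution, in the first $n$ indeterminates, of a solution of the $\sigma\pi$-ODE, i.e. it coincides on some open sub-interval of its interval of definition with the first $n$ components of a solution of the $\sigma\pi$-ODE. *)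

theory Defs
  imports "HOL-Analysis.Analysis"
begin

text \<open>Local expansion into a multivariate power series; the multi-indices are the functions
  \<open>\<alpha>\<close> from the standard basis to the natural numbers.  Convergence is unconditional, so no
  ordering of the multi-indices is involved.\<close>

definition real_analytic_on ::
    "('a::euclidean_space \<Rightarrow> 'b::real_normed_vector) \<Rightarrow> 'a set \<Rightarrow> bool"
  where "real_analytic_on f S \<longleftrightarrow>
    (\<forall>a\<in>S. \<exists>r>0. \<exists>c. \<forall>x\<in>ball a r.
       ((\<lambda>\<alpha>. (\<Prod>b\<in>Basis. ((x - a) \<bullet> b) ^ \<alpha> b) *\<^sub>R c \<alpha>) has_sum f x) (Basis \<rightarrow>\<^sub>E (UNIV :: nat set)))"

text \<open>The real power \<open>x\<^sup>p\<close> with a real exponent.  For integer \<open>p\<close> it is the algebraic power (so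
  \<open>0\<^sup>0 = 1\<close>, and an indeterminate with exponent 0 is absent from a monomial), defined for negative
  \<open>x\<close> as well; for other \<open>p\<close> it is \<open>exp (p * ln x)\<close> and requires \<open>x > 0\<close>.  Wherever the power is
  \<open>rpow_defined\<close> it is real analytic in \<open>x\<close>.  (Admitting \<open>x = 0\<close> for positive non-integer \<open>p\<close> would
  not enlarge any open set on which a monomial is defined.)\<close>

definition rpow :: "real \<Rightarrow> real \<Rightarrow> real"
  where "rpow x p = (if p \<in> \<int> then x powi \<lfloor>p\<rfloor> else x powr p)"

definition rpow_defined :: "real \<Rightarrow> real \<Rightarrow> bool"
  where "rpow_defined x p \<longleftrightarrow> x > 0 \<or> (p \<in> \<int> \<and> (x \<noteq> 0 \<or> p \<ge> 0))"

definition open_interval :: "real set \<Rightarrow> bool"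
  where "open_interval J \<longleftrightarrow> open J \<and> is_interval J \<and> J \<noteq> {}"

text \<open>Points of \<open>U\<close> are triples \<open>(x, y, t)\<close>, where \<open>y\<close> stands for the indeterminates
  \<open>dx/dt\<close>.  Component \<open>i\<close> of \<open>f\<close> has \<open>\<nu> i\<close> monomials.\<close>

definition analytic_sigma_pi ::
    "((real^'n) \<times> (real^'n) \<times> real) set \<Rightarrow> ((real^'n) \<times> (real^'n) \<times> real \<Rightarrow> real^'n) \<Rightarrow> bool"
  where "analytic_sigma_pi U f \<longleftrightarrow>
    open U \<and> real_analytic_on f U \<and>
    (\<exists>T (\<nu> :: 'n \<Rightarrow> nat) (v :: 'n \<Rightarrow> nat \<Rightarrow> real \<Rightarrow> real) p q.
       open_interval T \<and>
       (\<forall>i. \<forall>l<\<nu> i. real_analytic_on (v i l) T) \<and>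
       (\<forall>(x, y, t)\<in>U.
          t \<in> T \<and>
          (\<forall>i. \<forall>l<\<nu> i. \<forall>j. rpow_defined (x$j) (p i l j) \<and> rpow_defined (y$j) (q i l j)) \<and>
          (\<forall>i. f (x, y, t) $ i =
             (\<Sum>l<\<nu> i. v i l t * (\<Prod>j\<in>UNIV. rpow (x$j) (p i l j) * rpow (y$j) (q i l j))))))"

definition jacobian_xdot ::
    "((real^'n) \<times> (real^'n) \<times> real \<Rightarrow> real^'n) \<Rightarrow> (real^'n) \<times> (real^'n) \<times> real \<Rightarrow> real^'n^'n"
  where "jacobian_xdot f = (\<lambda>(x, y, t). jacobian (\<lambda>y'. f (x, y', t)) (at y))"

text \<open>The derivative of \<open>f\<close> with respect to the remaining variables \<open>(x, t)\<close>, as a linear map.\<close>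

definition deriv_xt ::
    "((real^'n) \<times> (real^'n) \<times> real \<Rightarrow> real^'n) \<Rightarrow> (real^'n) \<times> (real^'n) \<times> real
      \<Rightarrow> (real^'n) \<times> real \<Rightarrow> real^'n"
  where "deriv_xt f = (\<lambda>(x, y, t). frechet_derivative (\<lambda>(x', t'). f (x', y, t')) (at (x, t)))"

text \<open>Analyticity of \<open>\<phi>\<close> is not listed, as it is a consequence: \<open>\<phi>\<close> is differentiable, and the
  analytic equation \<open>f = 0\<close> with invertible Jacobian determines it locally.\<close>

definition explicit_local_rep ::
    "((real^'n) \<times> (real^'n) \<times> real \<Rightarrow> real^'n) \<Rightarrow> ((real^'n) \<times> (real^'n) \<times> real) set
      \<Rightarrow> (real^'n) \<times> (real^'n) \<times> real
      \<Rightarrow> ((real^'n) \<times> (real^'n) \<times> real) set \<Rightarrow> ((real^'n) \<times> real) set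
      \<Rightarrow> ((real^'n) \<times> real \<Rightarrow> real^'n) \<Rightarrow> bool"
  where "explicit_local_rep f U z U\<^sub>1 U\<^sub>2 \<phi> \<longleftrightarrow>
    open U\<^sub>1 \<and> U\<^sub>1 \<subseteq> U \<and> z \<in> U\<^sub>1 \<and>
    open U\<^sub>2 \<and> (fst z, snd (snd z)) \<in> U\<^sub>2 \<and>
    {w \<in> U. f w = 0} \<inter> U\<^sub>1 = {(x, \<phi> (x, t), t) | x t. (x, t) \<in> U\<^sub>2} \<and>
    (\<forall>(x, t)\<in>U\<^sub>2.
       invertible (jacobian_xdot f (x, \<phi> (x, t), t)) \<and>
       (\<phi> has_derivative
          (\<lambda>h. - (matrix_inv (jacobian_xdot f (x, \<phi> (x, t), t)) *v deriv_xt f (x, \<phi> (x, t), t) h)))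
         (at (x, t)))"

definition explicit_solution ::
    "((real^'n) \<times> real \<Rightarrow> real^'n) \<Rightarrow> ((real^'n) \<times> real) set \<Rightarrow> real set \<Rightarrow> (real \<Rightarrow> real^'n) \<Rightarrow> bool"
  where "explicit_solution \<phi> D J x \<longleftrightarrow>
    open_interval J \<and>
    (\<forall>t\<in>J. (x t, t) \<in> D \<and> (x has_vector_derivative \<phi> (x t, t)) (at t))"

text \<open>The indeterminates \<open>x\<^sub>1, \<dots>, x\<^sub>n\<close> are indexed by \<open>Inl i\<close> with \<open>i :: 'n\<close>, the additional ones
  \<open>x\<^sub>n\<^sub>+\<^sub>1, \<dots>, x\<^sub>n\<^sub>+\<^sub>d\<close> by \<open>Inr k\<close> with \<open>k < d\<close>.\<close>

definition indets :: "nat \<Rightarrow> ('n::finite + nat) set"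
  where "indets d = UNIV <+> {..<d}"

text \<open>A solution on \<open>J\<close> of the explicit \<open>\<sigma>\<pi>\<close>-ODE with monomial numbers \<open>\<nu>\<close>, coefficients \<open>v\<close> on
  \<open>T\<close>, and exponents \<open>p\<close>; the right-hand sides have to be defined along the solution.\<close>

definition sigma_pi_solution ::
    "nat \<Rightarrow> real set \<Rightarrow> ('n::finite + nat \<Rightarrow> nat) \<Rightarrow> ('n + nat \<Rightarrow> nat \<Rightarrow> real \<Rightarrow> real)
      \<Rightarrow> ('n + nat \<Rightarrow> nat \<Rightarrow> 'n + nat \<Rightarrow> real) \<Rightarrow> real set \<Rightarrow> ('n + nat \<Rightarrow> real \<Rightarrow> real) \<Rightarrow> bool"
  where "sigma_pi_solution d T \<nu> v p J X \<longleftrightarrow>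
    open_interval J \<and> J \<subseteq> T \<and>
    (\<forall>t\<in>J. \<forall>i\<in>indets d.
       (\<forall>l<\<nu> i. \<forall>j\<in>indets d. rpow_defined (X j t) (p i l j)) \<and>
       (X i has_real_derivative (\<Sum>l<\<nu> i. v i l t * (\<Prod>j\<in>indets d. rpow (X j t) (p i l j)))) (at t))"

definition sigma_pi_reducible ::
    "((real^'n) \<times> real \<Rightarrow> real^'n) \<Rightarrow> ((real^'n) \<times> real) set \<Rightarrow> bool"
  where "sigma_pi_reducible \<phi> D \<longleftrightarrow>
    (\<exists>d T (\<nu> :: 'n + nat \<Rightarrow> nat) v p.
       open_interval T \<and>
       (\<forall>i\<in>indets d. \<forall>l<\<nu> i. real_analytic_on (v i l) T) \<and>
       (\<forall>J x. explicit_solution \<phi> D J x \<longrightarrow>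
          (\<exists>J' X. J' \<subseteq> J \<and> sigma_pi_solution d T \<nu> v p J' X \<and>
                  (\<forall>t\<in>J'. \<forall>i. X (Inl i) t = x t $ i))))"

end

theory Submission
  imports Defs
begin

text \<open>
  Write \<open>y\<close> for the indeterminates \<open>dx/dt\<close> and \<open>A\<close> for the Jacobian of \<open>f\<close> with respect to \<open>y\<close>.
  Existence of an explicit local representation is the inverse function theorem applied to
  \<open>(x, y, t) \<mapsto> (x, f (x, y, t), t)\<close> (\<open>explicit_local_rep_exists\<close>).

  For the reduction, let \<open>x\<close> solve \<open>dx/dt = \<phi> (x, t)\<close> and put \<open>y t = \<phi> (x t, t)\<close>.  Differentiating
  \<open>f (x, y, t) = 0\<close> along the solution gives the linear system
  \<open>A (dy/dt) = - (\<partial>f/\<partial>x) y - \<partial>f/\<partial>t\<close>, which Cramer's rule solves for \<open>dy/dt\<close>.  All entries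
  are \<open>\<sigma>\<pi>\<close>-functions of \<open>(x, y, t)\<close>, because a partial derivative of a monomial is a monomial,
  and the \<open>\<sigma>\<pi>\<close>-functions form a ring, so that the determinants belong to it as well.  Only the
  division by \<open>det A\<close> leaves this ring.  It becomes admissible with one more indeterminate
  \<open>w = 1 / det A\<close>, since \<open>dw/dt = - w\<^sup>2 (d/dt) (det A)\<close> and the chain rule expresses the last
  factor by \<open>\<sigma>\<pi>\<close>-functions again.  Hence \<open>(x, y, w)\<close> satisfies an explicit \<open>\<sigma>\<pi>\<close>-ODE in \<open>2n + 1\<close>
  indeterminates, on the whole interval on which \<open>x\<close> is defined
  (\<open>sigma_pi_reducible_of_explicit_local_rep\<close>).

  The ring of \<open>\<sigma>\<pi>\<close>-functions is \<open>sigma_pi_on\<close>.  Its closure properties rest on analytic functions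
  of one variable being closed under products and derivatives, and on
  \<open>x\<^sup>p x\<^sup>q = x\<^sup>p\<^sup>+\<^sup>q\<close> wherever both powers are defined; the chain rule in the indeterminates is
  \<open>sigma_pi_on_has_derivative\<close>.
\<close>

section \<open>Real analytic functions of one variable\<close>

text \<open>With the single basis vector 1 a multi-index is just a natural number, and inside its
  interval of convergence a power series converges unconditionally.\<close>

lemma real_analytic_on_real_iff:
  fixes f :: "real \<Rightarrow> real"
  shows "real_analytic_on f S \<longleftrightarrow>
    (\<forall>a\<in>S. \<exists>r>0. \<exists>c. \<forall>x. \<bar>x - a\<bar> < r \<longrightarrow> (\<lambda>n. c n * (x - a) ^ n) sums f x)" (is "_ \<longleftrightarrow> ?R")
proof -
  let ?g = "\<lambda>n::nat. \<lambda>b\<in>{1::real}. n"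
  have inj: "inj ?g"
    by (metis (no_types, lifting) injI restrict_apply singletonI)
  have img: "range ?g = {1} \<rightarrow>\<^sub>E UNIV"
  proof
    show "{1} \<rightarrow>\<^sub>E UNIV \<subseteq> range ?g"
    proof
      fix \<alpha> :: "real \<Rightarrow> nat" assume "\<alpha> \<in> {1} \<rightarrow>\<^sub>E UNIV"
      then have "\<alpha> = ?g (\<alpha> 1)"
        by (auto simp: PiE_def extensional_def fun_eq_iff)
      then show "\<alpha> \<in> range ?g" by blast
    qed
  qed (auto simp: PiE_def)
  then have bij: "bij_betw ?g UNIV ({1} \<rightarrow>\<^sub>E UNIV)"
    using inj by (simp add: bij_betw_def)
  have multi: "((\<lambda>\<alpha>. (\<Prod>b\<in>Basis. ((x - a) \<bullet> b) ^ \<alpha> b) *\<^sub>R c \<alpha>) has_sum s) (Basis \<rightarrow>\<^sub>E UNIV)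
      \<longleftrightarrow> ((\<lambda>n. c (?g n) * (x - a) ^ n) has_sum s) UNIV" for x a s :: real and c
    using has_sum_reindex_bij_betw[OF bij, of "\<lambda>\<alpha>. (x - a) ^ \<alpha> 1 * c \<alpha>" s]
    by (simp add: mult.commute)
  show ?thesis
  proof
    assume an: "real_analytic_on f S"
    show ?R
    proof
      fix a assume "a \<in> S"
      then obtain r c where "r > 0"
        and "\<forall>x\<in>ball a r. ((\<lambda>n. c (?g n) * (x - a) ^ n) has_sum f x) UNIV"
        using an unfolding real_analytic_on_def multi by blast
      then have "\<forall>x. \<bar>x - a\<bar> < r \<longrightarrow> (\<lambda>n. c (?g n) * (x - a) ^ n) sums f x"
        by (auto simp: dist_real_def abs_minus_commute intro!: has_sum_imp_sums)
      with \<open>r > 0\<close> show "\<exists>r>0. \<exists>c. \<forall>x. \<bar>x - a\<bar> < r \<longrightarrow> (\<lambda>n. c n * (x - a) ^ n) sums f x"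
        by (intro exI[of _ r] conjI exI[of _ "\<lambda>n. c (?g n)"]) auto
    qed
  next
    assume R: ?R
    show "real_analytic_on f S"
      unfolding real_analytic_on_def multi
    proof
      fix a assume "a \<in> S"
      then obtain r c where r: "r > 0"
        and sums: "\<And>x. \<bar>x - a\<bar> < r \<Longrightarrow> (\<lambda>n. c n * (x - a) ^ n) sums f x"
        using R by blast
      have "((\<lambda>n. c n * (x - a) ^ n) has_sum f x) UNIV" if x: "\<bar>x - a\<bar> < r" for x
      proof (rule norm_summable_imp_has_sum[OF _ sums[OF x]])
        let ?s = "(\<bar>x - a\<bar> + r) / 2"
        have "summable (\<lambda>n. c n * ?s ^ n)"
          using sums[of "a + ?s"] x by (auto simp: sums_iff)
        then show "summable (\<lambda>n. norm (c n * (x - a) ^ n))"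
          by (rule powser_insidea) (use x in auto)
      qed
      then show "\<exists>r>0. \<exists>c. \<forall>x\<in>ball a r. ((\<lambda>n. c (?g n) * (x - a) ^ n) has_sum f x) UNIV"
        using r by (intro exI[of _ r] conjI exI[of _ "\<lambda>\<alpha>. c (\<alpha> 1)"])
          (auto simp: dist_real_def abs_minus_commute)
    qed
  qed
qed

lemma real_analytic_on_const: "real_analytic_on (\<lambda>_::real. k::real) S"
  unfolding real_analytic_on_real_iff
proof (intro ballI exI[of _ "1::real"] conjI exI[of _ "\<lambda>n. if n = 0 then k else 0"] allI impI)
  fix a x :: real
  show "(\<lambda>n. (if n = 0 then k else 0) * (x - a) ^ n) sums k"
    using sums_If_finite_set[of "{0}" "\<lambda>n. k * (x - a) ^ n"]
    by (simp add: if_distribR if_distrib[of "\<lambda>u. u * _"] cong: if_cong)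
qed simp

text \<open>The expansion of the product is the Cauchy product, which converges because both series
  converge absolutely inside the smaller of the two intervals.\<close>

lemma real_analytic_on_mult:
  fixes f g :: "real \<Rightarrow> real"
  assumes f: "real_analytic_on f S" and g: "real_analytic_on g S"
  shows "real_analytic_on (\<lambda>x. f x * g x) S"
  unfolding real_analytic_on_real_iff
proof
  fix a assume "a \<in> S"
  then obtain r c r' c' where r: "r > 0" "r' > 0"
    and c: "\<And>x. \<bar>x - a\<bar> < r \<Longrightarrow> (\<lambda>n. c n * (x - a) ^ n) sums f x"
    and c': "\<And>x. \<bar>x - a\<bar> < r' \<Longrightarrow> (\<lambda>n. c' n * (x - a) ^ n) sums g x"
    using f g unfolding real_analytic_on_real_iff by meson
  let ?d = "\<lambda>n. \<Sum>i\<le>n. c i * c' (n - i)"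
  have "(\<lambda>n. ?d n * (x - a) ^ n) sums (f x * g x)" if x: "\<bar>x - a\<bar> < min r r'" for x
  proof -
    \<comment> \<open>Absolute convergence at \<open>x\<close> follows from convergence slightly further out.\<close>
    let ?s = "(\<bar>x - a\<bar> + min r r') / 2"
    have s: "summable (\<lambda>n. c n * ?s ^ n)" "summable (\<lambda>n. c' n * ?s ^ n)"
      using c[of "a + ?s"] c'[of "a + ?s"] x by (auto simp: sums_iff)
    have "summable (\<lambda>n. norm (c n * (x - a) ^ n))"
      by (rule powser_insidea[OF s(1)]) (use x in auto)
    moreover have "summable (\<lambda>n. norm (c' n * (x - a) ^ n))"
      by (rule powser_insidea[OF s(2)]) (use x in auto)
    ultimately have "(\<lambda>n. \<Sum>i\<le>n. c i * (x - a) ^ i * (c' (n - i) * (x - a) ^ (n - i)))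
        sums ((\<Sum>n. c n * (x - a) ^ n) * (\<Sum>n. c' n * (x - a) ^ n))"
      by (rule Cauchy_product_sums)
    also have "(\<Sum>n. c n * (x - a) ^ n) * (\<Sum>n. c' n * (x - a) ^ n) = f x * g x"
      using c[of x] c'[of x] x by (simp add: sums_iff)
    also have "(\<lambda>n. \<Sum>i\<le>n. c i * (x - a) ^ i * (c' (n - i) * (x - a) ^ (n - i)))
        = (\<lambda>n. ?d n * (x - a) ^ n)"
    proof
      fix n
      show "(\<Sum>i\<le>n. c i * (x - a) ^ i * (c' (n - i) * (x - a) ^ (n - i))) = ?d n * (x - a) ^ n"
        unfolding sum_distrib_right
      proof (rule sum.cong)
        fix i assume "i \<in> {..n}"
        then have "(x - a) ^ n = (x - a) ^ i * (x - a) ^ (n - i)"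
          by (simp flip: power_add)
        then show "c i * (x - a) ^ i * (c' (n - i) * (x - a) ^ (n - i))
            = c i * c' (n - i) * (x - a) ^ n"
          by simp
      qed simp
    qed
    finally show ?thesis .
  qed
  then show "\<exists>r>0. \<exists>c. \<forall>x. \<bar>x - a\<bar> < r \<longrightarrow> (\<lambda>n. c n * (x - a) ^ n) sums (f x * g x)"
    using r by (intro exI[of _ "min r r'"] conjI exI[of _ ?d]) auto
qed

text \<open>A power series may be differentiated term by term inside its interval of convergence.\<close>

lemma real_analytic_on_has_derivative:
  fixes f :: "real \<Rightarrow> real"
  assumes f: "real_analytic_on f S"
  shows "real_analytic_on (deriv f) S" and "\<And>a. a \<in> S \<Longrightarrow> (f has_real_derivative deriv f a) (at a)"
proof -
  have main: "\<exists>r>0. \<exists>c. \<forall>x. \<bar>x - a\<bar> < r \<longrightarrow>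
      (f has_real_derivative deriv f x) (at x) \<and> (\<lambda>n. c n * (x - a) ^ n) sums deriv f x"
    if "a \<in> S" for a
  proof -
    obtain r c where r: "r > 0"
      and c: "\<And>x. \<bar>x - a\<bar> < r \<Longrightarrow> (\<lambda>n. c n * (x - a) ^ n) sums f x"
      using f \<open>a \<in> S\<close> unfolding real_analytic_on_real_iff by meson
    have sm: "summable (\<lambda>n. c n * h ^ n)" if "norm h < r" for h
      using c[of "a + h"] that by (auto simp: sums_iff)
    have "(f has_real_derivative deriv f x) (at x) \<and> (\<lambda>n. diffs c n * (x - a) ^ n) sums deriv f x"
      if x: "\<bar>x - a\<bar> < r" for x
    proof -
      have "((\<lambda>h. \<Sum>n. c n * h ^ n) has_real_derivative (\<Sum>n. diffs c n * (x - a) ^ n)) (at (x + - a))"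
        using termdiffs_strong'[OF sm, of r "x - a"] x by simp
      then have "((\<lambda>u. \<Sum>n. c n * (u + - a) ^ n) has_real_derivative
          (\<Sum>n. diffs c n * (x - a) ^ n)) (at x)"
        by (simp only: DERIV_shift)
      then have der: "(f has_real_derivative (\<Sum>n. diffs c n * (x - a) ^ n)) (at x)"
      proof (rule has_field_derivative_transform_within_open)
        show "open (ball a r)" "x \<in> ball a r"
          using x by (auto simp: dist_real_def)
        show "(\<Sum>n. c n * (u + - a) ^ n) = f u" if "u \<in> ball a r" for u
          using c[of u] that by (simp add: sums_iff dist_real_def abs_minus_commute)
      qed
      moreover have "summable (\<lambda>n. diffs c n * (x - a) ^ n)"
        by (rule termdiff_converges[OF _ sm]) (use x in auto)
      ultimately show ?thesis
        using DERIV_imp_deriv[OF der] by (simp add: sums_iff)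
    qed
    with r show ?thesis by blast
  qed
  show "real_analytic_on (deriv f) S"
    unfolding real_analytic_on_real_iff using main by meson
  show "(f has_real_derivative deriv f a) (at a)" if "a \<in> S" for a
    using main[OF that] by force
qed

section \<open>Real powers\<close>

lemma rpow_0_right [simp]: "rpow x 0 = 1"
  by (simp add: rpow_def)

lemma rpow_1_right [simp]: "rpow x 1 = x"
  by (simp add: rpow_def)

lemma rpow_defined_0 [simp]: "rpow_defined x 0"
  by (simp add: rpow_defined_def)

lemma rpow_defined_1 [simp]: "rpow_defined x 1"
  by (simp add: rpow_defined_def)

lemma rpow_of_int: "rpow x (of_int m) = x powi m"
  by (simp add: rpow_def)

lemma rpow_of_pos: "x > 0 \<Longrightarrow> rpow x p = x powr p"
  by (auto simp: rpow_def powr_real_of_int' elim!: Ints_cases)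

text \<open>At \<open>x = 0\<close>, where the law of exponents can fail, definedness of both powers forces both
  exponents to be nonnegative integers.\<close>

lemma rpow_add:
  assumes "rpow_defined x p" "rpow_defined x q"
  shows "rpow_defined x (p + q)" and "rpow x (p + q) = rpow x p * rpow x q"
proof -
  show "rpow_defined x (p + q)"
    using assms by (auto simp: rpow_defined_def)
  show "rpow x (p + q) = rpow x p * rpow x q"
  proof (cases "x > 0")
    case True
    then show ?thesis by (simp add: rpow_of_pos powr_add)
  next
    case False
    then obtain m n where mn: "p = of_int m" "q = of_int n" and "x \<noteq> 0 \<or> m \<ge> 0 \<and> n \<ge> 0"
      using assms by (auto simp: rpow_defined_def elim!: Ints_cases)
    then have "x powi (m + n) = x powi m * x powi n"
      by (cases "x = 0 \<and> m + n = 0") (auto simp: add_nonneg_eq_0_iff intro!: power_int_add)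
    then show ?thesis
      unfolding mn of_int_add [symmetric] rpow_of_int .
  qed
qed

text \<open>The exponent 0 is special, as \<open>x\<^sup>-\<^sup>1\<close> may be undefined while \<open>x\<^sup>0\<close> is defined; the formula for the
  derivative survives because its factor \<open>p\<close> vanishes.\<close>

lemma rpow_has_derivative:
  assumes "rpow_defined x p"
  shows "p \<noteq> 0 \<Longrightarrow> rpow_defined x (p - 1)"
    and "((\<lambda>x. rpow x p) has_real_derivative p * rpow x (p - 1)) (at x)"
proof -
  show "rpow_defined x (p - 1)" if "p \<noteq> 0"
    using assms that by (fastforce simp: rpow_defined_def elim!: Ints_cases)
  show "((\<lambda>x. rpow x p) has_real_derivative p * rpow x (p - 1)) (at x)"
  proof (cases "x > 0")
    case True
    have "((\<lambda>x. x powr p) has_real_derivative p * x powr (p - 1)) (at x)"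
      by (rule has_real_derivative_powr[OF True])
    then have "((\<lambda>x. rpow x p) has_real_derivative p * x powr (p - 1)) (at x)"
      by (rule has_field_derivative_transform_within_open[of _ _ _ "{0<..}"])
        (auto simp: True rpow_of_pos)
    then show ?thesis by (simp add: rpow_of_pos True)
  next
    case False
    then obtain m where m: "p = of_int m" and "m \<ge> 0 \<or> x \<noteq> 0"
      using assms by (auto simp: rpow_defined_def elim!: Ints_cases)
    then have "((\<lambda>x. x powi m) has_real_derivative of_int m * x powi (m - 1)) (at x)"
      by (auto intro!: derivative_eq_intros)
    moreover have "p - 1 = of_int (m - 1)" by (simp add: m)
    ultimately show ?thesis
      by (simp only: m rpow_of_int)
  qed
qed

section \<open>The ring of \<open>\<sigma>\<pi>\<close>-functions\<close>

text \<open>A semantic notion: \<open>g\<close> is arbitrary outside \<open>D\<close> and has no chosen representation, so that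
  determinants or \<open>f\<close> itself can be members directly.\<close>

definition sigma_pi_on ::
    "'i set \<Rightarrow> real set \<Rightarrow> (('i \<Rightarrow> real) \<times> real) set \<Rightarrow> (('i \<Rightarrow> real) \<Rightarrow> real \<Rightarrow> real) \<Rightarrow> bool"
  where "sigma_pi_on I T D g \<longleftrightarrow>
    (\<exists>(N::nat) v p. (\<forall>l<N. real_analytic_on (v l) T) \<and>
      (\<forall>X t. (X, t) \<in> D \<longrightarrow>
        (\<forall>l<N. \<forall>j\<in>I. rpow_defined (X j) (p l j)) \<and>
        g X t = (\<Sum>l<N. v l t * (\<Prod>j\<in>I. rpow (X j) (p l j)))))"

lemma sigma_pi_onE:
  assumes "sigma_pi_on I T D g"
  obtains N :: nat and v p where "\<And>l. l < N \<Longrightarrow> real_analytic_on (v l) T"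
    and "\<And>X t l j. (X, t) \<in> D \<Longrightarrow> l < N \<Longrightarrow> j \<in> I \<Longrightarrow> rpow_defined (X j) (p l j)"
    and "\<And>X t. (X, t) \<in> D \<Longrightarrow> g X t = (\<Sum>l<N. v l t * (\<Prod>j\<in>I. rpow (X j) (p l j)))"
  using assms unfolding sigma_pi_on_def by blast

lemma sigma_pi_on_cong:
  assumes "sigma_pi_on I T D g" and "\<And>X t. (X, t) \<in> D \<Longrightarrow> h X t = g X t"
  shows "sigma_pi_on I T D h"
  using assms(1) unfolding sigma_pi_on_def by (simp add: assms(2) cong: imp_cong)

lemma sigma_pi_on_monomial:
  assumes "real_analytic_on v T"
    and "\<And>X t j. (X, t) \<in> D \<Longrightarrow> j \<in> I \<Longrightarrow> rpow_defined (X j) (p j)"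
  shows "sigma_pi_on I T D (\<lambda>X t. v t * (\<Prod>j\<in>I. rpow (X j) (p j)))"
  unfolding sigma_pi_on_def
  by (rule exI[of _ 1], rule exI[of _ "\<lambda>_. v"], rule exI[of _ "\<lambda>_. p"]) (use assms in auto)

lemma sigma_pi_on_const: "sigma_pi_on I T D (\<lambda>X t. k)"
  using sigma_pi_on_monomial[of "\<lambda>_. k" T D I "\<lambda>_. 0"] by (simp add: real_analytic_on_const)

lemma sigma_pi_on_indeterminate:
  assumes "finite I" "i \<in> I"
  shows "sigma_pi_on I T D (\<lambda>X t. X i)"
proof -
  have "sigma_pi_on I T D (\<lambda>X t. 1 * (\<Prod>j\<in>I. rpow (X j) (if j = i then 1 else 0)))"
    by (intro sigma_pi_on_monomial real_analytic_on_const) auto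
  moreover have "(\<Prod>j\<in>I. rpow (X j) (if j = i then 1 else 0)) = X i" for X
    using assms by (simp add: if_distrib cong: if_cong)
  ultimately show ?thesis by simp
qed

lemma sigma_pi_on_add:
  assumes "sigma_pi_on I T D g" "sigma_pi_on I T D h"
  shows "sigma_pi_on I T D (\<lambda>X t. g X t + h X t)"
proof -
  obtain N :: nat and v p where g: "\<And>l. l < N \<Longrightarrow> real_analytic_on (v l) T"
      "\<And>X t l j. (X, t) \<in> D \<Longrightarrow> l < N \<Longrightarrow> j \<in> I \<Longrightarrow> rpow_defined (X j) (p l j)"
      "\<And>X t. (X, t) \<in> D \<Longrightarrow> g X t = (\<Sum>l<N. v l t * (\<Prod>j\<in>I. rpow (X j) (p l j)))"
    using sigma_pi_onE[OF assms(1)] by blast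
  obtain M :: nat and w q where h: "\<And>l. l < M \<Longrightarrow> real_analytic_on (w l) T"
      "\<And>X t l j. (X, t) \<in> D \<Longrightarrow> l < M \<Longrightarrow> j \<in> I \<Longrightarrow> rpow_defined (X j) (q l j)"
      "\<And>X t. (X, t) \<in> D \<Longrightarrow> h X t = (\<Sum>l<M. w l t * (\<Prod>j\<in>I. rpow (X j) (q l j)))"
    using sigma_pi_onE[OF assms(2)] by blast
  define v' where "v' = (\<lambda>l. if l < N then v l else w (l - N))"
  define p' where "p' = (\<lambda>l. if l < N then p l else q (l - N))"
  have "g X t + h X t = (\<Sum>l<N + M. v' l t * (\<Prod>j\<in>I. rpow (X j) (p' l j)))" if "(X, t) \<in> D" for X t
  proof -
    have "(\<Sum>l<N + M. v' l t * (\<Prod>j\<in>I. rpow (X j) (p' l j)))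
        = (\<Sum>l<N. v' l t * (\<Prod>j\<in>I. rpow (X j) (p' l j)))
          + (\<Sum>l<M. v' (N + l) t * (\<Prod>j\<in>I. rpow (X j) (p' (N + l) j)))"
      by (induction M) (simp_all add: add.assoc)
    then show ?thesis
      using that by (simp add: g h v'_def p'_def)
  qed
  then show ?thesis
    unfolding sigma_pi_on_def
    by (intro exI[of _ "N + M"] exI[of _ v'] exI[of _ p']) (auto simp: v'_def p'_def g(1,2) h(1,2))
qed

lemma sigma_pi_on_sum:
  assumes "\<And>s. s \<in> S \<Longrightarrow> sigma_pi_on I T D (g s)"
  shows "sigma_pi_on I T D (\<lambda>X t. \<Sum>s\<in>S. g s X t)"
  using assms by (induction S rule: infinite_finite_induct)
    (auto intro: sigma_pi_on_const sigma_pi_on_add)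

text \<open>Multiplying out, the exponents of two monomials add up.\<close>

lemma sigma_pi_on_mult:
  assumes "sigma_pi_on I T D g" "sigma_pi_on I T D h"
  shows "sigma_pi_on I T D (\<lambda>X t. g X t * h X t)"
proof -
  obtain N :: nat and v p where g: "\<And>l. l < N \<Longrightarrow> real_analytic_on (v l) T"
      "\<And>X t l j. (X, t) \<in> D \<Longrightarrow> l < N \<Longrightarrow> j \<in> I \<Longrightarrow> rpow_defined (X j) (p l j)"
      "\<And>X t. (X, t) \<in> D \<Longrightarrow> g X t = (\<Sum>l<N. v l t * (\<Prod>j\<in>I. rpow (X j) (p l j)))"
    using sigma_pi_onE[OF assms(1)] by blast
  obtain M :: nat and w q where h: "\<And>l. l < M \<Longrightarrow> real_analytic_on (w l) T"
      "\<And>X t l j. (X, t) \<in> D \<Longrightarrow> l < M \<Longrightarrow> j \<in> I \<Longrightarrow> rpow_defined (X j) (q l j)"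
      "\<And>X t. (X, t) \<in> D \<Longrightarrow> h X t = (\<Sum>l<M. w l t * (\<Prod>j\<in>I. rpow (X j) (q l j)))"
    using sigma_pi_onE[OF assms(2)] by blast
  have "sigma_pi_on I T D (\<lambda>X t. \<Sum>l<N. \<Sum>m<M.
      (v l t * w m t) * (\<Prod>j\<in>I. rpow (X j) (p l j + q m j)))"
    by (intro sigma_pi_on_sum sigma_pi_on_monomial real_analytic_on_mult)
      (auto intro: g h rpow_add(1))
  then show ?thesis
  proof (rule sigma_pi_on_cong)
    fix X t assume XD: "(X, t) \<in> D"
    have eq: "v l t * (\<Prod>j\<in>I. rpow (X j) (p l j)) * (w m t * (\<Prod>j\<in>I. rpow (X j) (q m j)))
        = (v l t * w m t) * (\<Prod>j\<in>I. rpow (X j) (p l j + q m j))" if "l < N" "m < M" for l m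
      using that XD g(2) h(2) by (simp add: rpow_add(2) prod.distrib cong: prod.cong)
    then show "g X t * h X t = (\<Sum>l<N. \<Sum>m<M.
      (v l t * w m t) * (\<Prod>j\<in>I. rpow (X j) (p l j + q m j)))"
      unfolding g(3)[OF XD] h(3)[OF XD] sum_product by (intro sum.cong refl eq) auto
  qed
qed

lemma sigma_pi_on_uminus:
  "sigma_pi_on I T D g \<Longrightarrow> sigma_pi_on I T D (\<lambda>X t. - g X t)"
  using sigma_pi_on_mult[OF sigma_pi_on_const[of I T D "-1"]] by simp

lemma sigma_pi_on_prod:
  assumes "\<And>s. s \<in> S \<Longrightarrow> sigma_pi_on I T D (g s)"
  shows "sigma_pi_on I T D (\<lambda>X t. \<Prod>s\<in>S. g s X t)"
  using assms by (induction S rule: infinite_finite_induct)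
    (auto intro: sigma_pi_on_const sigma_pi_on_mult)

text \<open>By the Leibniz formula a determinant is a polynomial in the entries.\<close>

lemma sigma_pi_on_det:
  fixes A :: "'n::finite \<Rightarrow> 'n \<Rightarrow> ('i \<Rightarrow> real) \<Rightarrow> real \<Rightarrow> real"
  assumes "\<And>i j. sigma_pi_on I T D (A i j)"
  shows "sigma_pi_on I T D (\<lambda>X t. det (\<chi> i j. A i j X t))"
  unfolding det_def vec_lambda_beta
  by (intro sigma_pi_on_sum sigma_pi_on_mult sigma_pi_on_const sigma_pi_on_prod assms)

text \<open>The indeterminates are arbitrary differentiable functions \<open>u j\<close>, so that the one lemma covers
  curves as well as coordinate functions.\<close>

lemma monomial_has_derivative:
  fixes a :: "'a::real_normed_vector"
  assumes "finite I"
    and u: "\<And>j. j \<in> I \<Longrightarrow> (u j has_derivative u' j) (at a)"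
    and \<tau>: "(\<tau> has_derivative \<tau>') (at a)"
    and v: "(v has_real_derivative v') (at (\<tau> a))"
    and p: "\<And>j. j \<in> I \<Longrightarrow> rpow_defined (u j a) (p j)"
  shows "((\<lambda>b. v (\<tau> b) * (\<Prod>j\<in>I. rpow (u j b) (p j))) has_derivative
    (\<lambda>h. (\<Sum>k\<in>I. p k * v (\<tau> a) * (\<Prod>j\<in>I. rpow (u j a) ((p(k := p k - 1)) j)) * u' k h)
       + v' * (\<Prod>j\<in>I. rpow (u j a) (p j)) * \<tau>' h)) (at a)"
proof -
  have 1: "((\<lambda>b. v (\<tau> b)) has_derivative (\<lambda>h. v' * \<tau>' h)) (at a)"
    using has_derivative_compose[OF \<tau>] v by (simp add: has_field_derivative_def)
  have "((\<lambda>b. rpow (u j b) (p j)) has_derivative (\<lambda>h. p j * rpow (u j a) (p j - 1) * u' j h)) (at a)"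
    if "j \<in> I" for j
    using has_derivative_compose[OF u[OF that]] rpow_has_derivative(2)[OF p[OF that]]
    by (simp add: has_field_derivative_def)
  note 2 = has_derivative_prod[OF this]
  have 3: "(\<Prod>j\<in>I. rpow (u j a) ((p(k := p k - 1)) j))
      = rpow (u k a) (p k - 1) * (\<Prod>j\<in>I - {k}. rpow (u j a) (p j))" if "k \<in> I" for k
    by (subst prod.remove[OF \<open>finite I\<close> that]) (auto intro!: prod.cong)
  show ?thesis
    by (rule has_derivative_eq_rhs[OF has_derivative_mult[OF 1 2]])
      (auto simp: 3 sum_distrib_left fun_eq_iff mult_ac simp del: fun_upd_apply intro!: sum.cong)
qed

text \<open>The chain rule, with partial derivatives \<open>G k\<close> and \<open>H\<close> that are again \<open>\<sigma>\<pi>\<close>-functions.  It is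
  stated for substituted functions \<open>u\<close> and \<open>\<tau>\<close> with values in \<open>D\<close>, since \<open>D\<close> lies in a
  function space without a norm.\<close>

lemma sigma_pi_on_has_derivative:
  fixes g :: "('i \<Rightarrow> real) \<Rightarrow> real \<Rightarrow> real"
  assumes g: "sigma_pi_on I T D g" and "finite I" and D: "D \<subseteq> UNIV \<times> T"
  obtains G H where "\<And>k. sigma_pi_on I T D (G k)" and "sigma_pi_on I T D H"
    and "\<And>u u' \<tau> \<tau>' (a::'a::real_normed_vector).
      (\<forall>\<^sub>F b in nhds a. ((\<lambda>j. u j b), \<tau> b) \<in> D) \<Longrightarrow>
      (\<And>j. j \<in> I \<Longrightarrow> (u j has_derivative u' j) (at a)) \<Longrightarrow> (\<tau> has_derivative \<tau>') (at a) \<Longrightarrow>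
      ((\<lambda>b. g (\<lambda>j. u j b) (\<tau> b)) has_derivative
        (\<lambda>h. (\<Sum>k\<in>I. G k (\<lambda>j. u j a) (\<tau> a) * u' k h) + H (\<lambda>j. u j a) (\<tau> a) * \<tau>' h)) (at a)"
proof -
  obtain N :: nat and v p where v: "\<And>l. l < N \<Longrightarrow> real_analytic_on (v l) T"
    and p: "\<And>X t l j. (X, t) \<in> D \<Longrightarrow> l < N \<Longrightarrow> j \<in> I \<Longrightarrow> rpow_defined (X j) (p l j)"
    and g: "\<And>X t. (X, t) \<in> D \<Longrightarrow> g X t = (\<Sum>l<N. v l t * (\<Prod>j\<in>I. rpow (X j) (p l j)))"
    using sigma_pi_onE[OF g] by blast
  define G where "G = (\<lambda>k X t. \<Sum>l<N. p l k * v l t * (\<Prod>j\<in>I. rpow (X j) (((p l)(k := p l k - 1)) j)))"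
  define H where "H = (\<lambda>X t. \<Sum>l<N. deriv (v l) t * (\<Prod>j\<in>I. rpow (X j) (p l j)))"
  show thesis
  proof
    show "sigma_pi_on I T D (G k)" for k
      unfolding G_def
    proof (rule sigma_pi_on_sum)
      fix l assume l: "l \<in> {..<N}"
      show "sigma_pi_on I T D (\<lambda>X t. p l k * v l t * (\<Prod>j\<in>I. rpow (X j) (((p l)(k := p l k - 1)) j)))"
      \<comment> \<open>For exponent 0 the summand is dropped: its power \<open>-1\<close> need not be defined.\<close>
      proof (cases "p l k = 0")
        case True
        then show ?thesis using sigma_pi_on_const[of I T D 0] by simp
      next
        case False
        then show ?thesis
          using l by (intro sigma_pi_on_monomial real_analytic_on_mult real_analytic_on_const)
            (auto intro: v p rpow_has_derivative(1))
      qed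
    qed
    show "sigma_pi_on I T D H"
      unfolding H_def
      by (intro sigma_pi_on_sum sigma_pi_on_monomial real_analytic_on_has_derivative(1)) (auto intro: v p)
    fix u :: "'i \<Rightarrow> 'a \<Rightarrow> real" and u' \<tau> \<tau>' and a :: 'a
    assume ev: "\<forall>\<^sub>F b in nhds a. ((\<lambda>j. u j b), \<tau> b) \<in> D"
      and u: "\<And>j. j \<in> I \<Longrightarrow> (u j has_derivative u' j) (at a)" and \<tau>: "(\<tau> has_derivative \<tau>') (at a)"
    have aD: "((\<lambda>j. u j a), \<tau> a) \<in> D"
      using eventually_nhds_x_imp_x[OF ev] .
    have ev': "\<forall>\<^sub>F b in nhds a. (\<Sum>l<N. v l (\<tau> b) * (\<Prod>j\<in>I. rpow (u j b) (p l j))) = g (\<lambda>j. u j b) (\<tau> b)"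
      using ev by eventually_elim (simp add: g)
    have "((\<lambda>b. \<Sum>l<N. v l (\<tau> b) * (\<Prod>j\<in>I. rpow (u j b) (p l j))) has_derivative (\<lambda>h. \<Sum>l<N.
        (\<Sum>k\<in>I. p l k * v l (\<tau> a) * (\<Prod>j\<in>I. rpow (u j a) (((p l)(k := p l k - 1)) j)) * u' k h)
          + deriv (v l) (\<tau> a) * (\<Prod>j\<in>I. rpow (u j a) (p l j)) * \<tau>' h)) (at a)"
      using aD D
      by (intro has_derivative_sum monomial_has_derivative \<open>finite I\<close> u \<tau>
          real_analytic_on_has_derivative(2)[OF v] p[OF aD]) auto
    also have "(\<lambda>h. \<Sum>l<N.
        (\<Sum>k\<in>I. p l k * v l (\<tau> a) * (\<Prod>j\<in>I. rpow (u j a) (((p l)(k := p l k - 1)) j)) * u' k h)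
          + deriv (v l) (\<tau> a) * (\<Prod>j\<in>I. rpow (u j a) (p l j)) * \<tau>' h)
      = (\<lambda>h. (\<Sum>k\<in>I. G k (\<lambda>j. u j a) (\<tau> a) * u' k h) + H (\<lambda>j. u j a) (\<tau> a) * \<tau>' h)"
      unfolding G_def H_def sum.distrib sum_distrib_right by (subst sum.swap) (rule refl)
    finally show "((\<lambda>b. g (\<lambda>j. u j b) (\<tau> b)) has_derivative
        (\<lambda>h. (\<Sum>k\<in>I. G k (\<lambda>j. u j a) (\<tau> a) * u' k h) + H (\<lambda>j. u j a) (\<tau> a) * \<tau>' h)) (at a)"
      by (rule has_derivative_transform_eventually)
        (use ev' eventually_nhds_x_imp_x[OF ev'] in \<open>auto simp: eventually_at_filter elim: eventually_mono\<close>)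
  qed
qed

section \<open>Existence of an explicit local representation\<close>

text \<open>Both partial derivatives are restrictions of the total derivative.\<close>

lemma jacobian_deriv_xt_split:
  fixes f :: "(real^'n) \<times> (real^'n) \<times> real \<Rightarrow> real^'n"
  assumes f: "(f has_derivative f') (at (x, y, t))"
  shows "f' (hx, hy, s) = jacobian_xdot f (x, y, t) *v hy + deriv_xt f (x, y, t) (hx, s)"
proof -
  have lin: "linear f'"
    using f by (rule has_derivative_linear)
  have "((\<lambda>y'. (x, y', t)) has_derivative (\<lambda>h. (0, h, 0))) (at y)"
    by (auto intro!: derivative_eq_intros)
  from has_derivative_compose[OF this f]
  have *: "((\<lambda>y'. f (x, y', t)) has_derivative (\<lambda>h. f' (0, h, 0))) (at y)" .
  then have "((\<lambda>y'. f (x, y', t)) has_derivative (\<lambda>h. jacobian_xdot f (x, y, t) *v h)) (at y)"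
    unfolding jacobian_xdot_def prod.case by (auto simp flip: jacobian_works intro: differentiableI)
  from has_derivative_unique[OF * this]
  have jac: "f' (0, hy, 0) = jacobian_xdot f (x, y, t) *v hy"
    by meson
  have "((\<lambda>(x', t'). (x', y, t')) has_derivative (\<lambda>(hx, s). (hx, 0, s))) (at (x, t))"
    by (auto simp: case_prod_unfold intro!: derivative_eq_intros)
  from has_derivative_compose[OF this, of f f'] f
  have "((\<lambda>(x', t'). f (x', y, t')) has_derivative (\<lambda>(hx, s). f' (hx, 0, s))) (at (x, t))"
    by (simp add: case_prod_unfold)
  from frechet_derivative_at[OF this] have "f' (hx, 0, s) = deriv_xt f (x, y, t) (hx, s)"
    unfolding deriv_xt_def prod.case by (metis (no_types, lifting) case_prod_conv)
  moreover have "f' (hx, hy, s) = f' (0, hy, 0) + f' (hx, 0, s)"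
    by (simp flip: linear_add[OF lin])
  ultimately show ?thesis
    by (simp add: jac)
qed

lemma matrix_inv_mult:
  fixes A :: "real^'n^'n"
  assumes "invertible A"
  shows "matrix_inv A ** A = mat 1" and "A ** matrix_inv A = mat 1"
  using someI_ex[OF assms[unfolded invertible_def]] by (simp_all add: matrix_inv_def)

text \<open>The map \<open>F (x, y, t) = (x, f (x, y, t), t)\<close> is a local diffeomorphism at \<open>z\<close>, because an element of
  the kernel of its derivative has the form \<open>(0, k, 0)\<close> with \<open>k\<close> in the kernel of the Jacobian.  The
  local zeros of \<open>f\<close> are the preimages of the points \<open>(x, 0, t)\<close>, so \<open>\<phi> (x, t)\<close> is the middle
  component of the local inverse at \<open>(x, 0, t)\<close>.\<close>

lemma explicit_local_rep_exists:
  fixes f :: "(real^'n) \<times> (real^'n) \<times> real \<Rightarrow> real^'n"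
  assumes U: "open U"
    and f: "\<And>w. w \<in> U \<Longrightarrow> (f has_derivative f' w) (at w)"
    and cont: "\<And>h. continuous_on U (\<lambda>w. f' w h)"
    and z: "z \<in> U" "f z = 0" and inv: "invertible (jacobian_xdot f z)"
  shows "\<exists>U\<^sub>1 U\<^sub>2 \<phi>. explicit_local_rep f U z U\<^sub>1 U\<^sub>2 \<phi>"
proof -
  define F where "F = (\<lambda>w. (fst w, f w, snd (snd w)))"
  define F' where "F' = (\<lambda>w h. (fst h, f' w h, snd (snd h)))"
  have F: "(F has_derivative F' w) (at w)" if "w \<in> U" for w
    unfolding F_def F'_def by (auto intro!: derivative_eq_intros f[OF that])
  then have blF: "blinfun_apply (Blinfun (F' w)) = F' w" if "w \<in> U" for w
    using that by (intro bounded_linear_Blinfun_apply has_derivative_bounded_linear)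
  have contF: "continuous_on U (\<lambda>w. Blinfun (F' w))"
  proof (rule continuous_on_blinfun_componentwise)
    fix h
    have "continuous_on U (\<lambda>w. F' w h)"
      unfolding F'_def by (intro continuous_intros cont)
    then show "continuous_on U (\<lambda>w. Blinfun (F' w) h)"
      by (rule continuous_on_eq) (simp add: blF)
  qed
  have split: "f' w h = jacobian_xdot f w *v fst (snd h) + deriv_xt f w (fst h, snd (snd h))"
    if "w \<in> U" for w h
    using jacobian_deriv_xt_split[of f "f' w" "fst w" "fst (snd w)" "snd (snd w)"
        "fst h" "fst (snd h)" "snd (snd h)"] f[OF that] by simp
  have deriv_xt_0: "deriv_xt f w (0, 0) = 0" if "w \<in> U" for w
    using split[OF that, of 0] linear_0[OF has_derivative_linear[OF f[OF that]]]
    by (simp add: zero_prod_def)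
  have "inj (F' z)"
    unfolding linear_injective_0[OF has_derivative_linear[OF F[OF z(1)]]]
  proof (intro allI impI)
    fix h assume h: "F' z h = 0"
    then have "fst h = 0" "snd (snd h) = 0" "f' z h = 0"
      by (simp_all add: F'_def zero_prod_def)
    then have "jacobian_xdot f z *v fst (snd h) = 0"
      using split[OF z(1), of h] deriv_xt_0[OF z(1)] by simp
    then have "fst (snd h) = 0"
      using inv by (metis invertible_left_inverse matrix_left_invertible_ker)
    with h show "h = 0"
      by (simp add: F'_def zero_prod_def prod_eq_iff)
  qed
  then obtain G where G: "linear G" "G \<circ> F' z = id"
    using linear_injective_left_inverse[OF has_derivative_linear[OF F[OF z(1)]]] by blast
  then have "Blinfun G o\<^sub>L Blinfun (F' z) = id_blinfun"
    by (intro blinfun_eqI)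
      (simp add: blF[OF z(1)] bounded_linear_Blinfun_apply linear_conv_bounded_linear pointfree_idE)
  then obtain U' V g g' where U': "open U'" "U' \<subseteq> U" "z \<in> U'" and V: "open V" "F z \<in> V"
    and hom: "homeomorphism U' V F g"
    and g: "\<And>v. v \<in> V \<Longrightarrow> (g has_derivative (g' v)) (at v)"
    and g': "\<And>v. v \<in> V \<Longrightarrow> g' v = Hilbert_Choice.inv (blinfun_apply (Blinfun (F' (g v))))"
    and bij: "\<And>v. v \<in> V \<Longrightarrow> bij (blinfun_apply (Blinfun (F' (g v))))"
    using inverse_function_theorem[OF U, of F "\<lambda>w. Blinfun (F' w)" z "Blinfun G"]
      F blF contF z(1) by metis
  define U2 where "U2 = {(x, t). (x, 0, t) \<in> V}"
  define \<phi> where "\<phi> = (\<lambda>(x, t). fst (snd (g (x, 0, t))))"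
  have gV: "g v \<in> U'" "F (g v) = v" if "v \<in> V" for v
    using hom that by (auto simp: homeomorphism_def)
  have graph: "g (x, 0, t) = (x, \<phi> (x, t), t)" "f (x, \<phi> (x, t), t) = 0" "(x, \<phi> (x, t), t) \<in> U'"
    if "(x, t) \<in> U2" for x t
  proof -
    have v: "(x, 0, t) \<in> V" using that by (simp add: U2_def)
    show 1: "g (x, 0, t) = (x, \<phi> (x, t), t)"
      using gV(2)[OF v] by (simp add: F_def \<phi>_def prod_eq_iff)
    then show "f (x, \<phi> (x, t), t) = 0" "(x, \<phi> (x, t), t) \<in> U'"
      using gV[OF v] by (simp_all add: F_def)
  qed
  have "open U2"
  proof -
    have "U2 = (\<lambda>q. (fst q, 0, snd q)) -` V" by (auto simp: U2_def)
    moreover have "open ((\<lambda>q. (fst q, 0, snd q)) -` V)"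
      using V(1) by (rule open_vimage) (intro continuous_intros)
    ultimately show ?thesis by metis
  qed
  moreover have "(fst z, snd (snd z)) \<in> U2"
    using V(2) z(2) by (simp add: U2_def F_def)
  moreover have "{w \<in> U. f w = 0} \<inter> U' = {(x, \<phi> (x, t), t) | x t. (x, t) \<in> U2}"
  proof (intro equalityI subsetI)
    fix w assume w: "w \<in> {w \<in> U. f w = 0} \<inter> U'"
    then have "F w \<in> V" "g (F w) = w"
      using hom by (auto simp: homeomorphism_def)
    with w show "w \<in> {(x, \<phi> (x, t), t) | x t. (x, t) \<in> U2}"
      by (cases w) (auto simp: F_def U2_def \<phi>_def)
  next
    fix w assume "w \<in> {(x, \<phi> (x, t), t) | x t. (x, t) \<in> U2}"
    then show "w \<in> {w \<in> U. f w = 0} \<inter> U'"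
      using graph(2,3) U'(2) by auto
  qed
  moreover have "invertible (jacobian_xdot f (x, \<phi> (x, t), t)) \<and>
       (\<phi> has_derivative
          (\<lambda>h. - (matrix_inv (jacobian_xdot f (x, \<phi> (x, t), t)) *v deriv_xt f (x, \<phi> (x, t), t) h)))
         (at (x, t))" if xt: "(x, t) \<in> U2" for x t
  proof
    let ?w = "(x, \<phi> (x, t), t)" and ?v = "(x, 0, t)"
    have v: "?v \<in> V" using xt by (simp add: U2_def)
    have w: "?w \<in> U" using graph(3)[OF xt] U'(2) by blast
    have bijF: "bij (F' ?w)" and g'F: "g' ?v = Hilbert_Choice.inv (F' ?w)"
      using bij[OF v] g'[OF v] by (simp_all add: graph(1)[OF xt] blF[OF w])
    have "k = 0" if k: "jacobian_xdot f ?w *v k = 0" for k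
    proof -
      have "F' ?w (0, k, 0) = F' ?w 0"
        using k split[OF w] deriv_xt_0[OF w] by (simp add: F'_def)
      then show "k = 0"
        using bijF by (simp add: bij_def inj_eq zero_prod_def)
    qed
    then show inv: "invertible (jacobian_xdot f ?w)"
      by (simp add: invertible_left_inverse matrix_left_invertible_ker)
    have "((\<lambda>q. (fst q, 0, snd q)) has_derivative (\<lambda>h. (fst h, 0, snd h))) (at (x, t))"
      by (auto intro!: derivative_eq_intros)
    from has_derivative_compose[OF this, of g "g' ?v"] g[OF v]
    have "((\<lambda>q. fst (snd (g (fst q, 0, snd q)))) has_derivative
        (\<lambda>h. fst (snd (g' ?v (fst h, 0, snd h))))) (at (x, t))"
      by (intro has_derivative_fst has_derivative_snd) simp
    moreover have "fst (snd (g' ?v (fst h, 0, snd h)))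
        = - (matrix_inv (jacobian_xdot f ?w) *v deriv_xt f ?w h)" for h
    proof -
      obtain hx k s where k: "g' ?v (fst h, 0, snd h) = (hx, k, s)" by (metis prod_cases3)
      have "F' ?w (g' ?v (fst h, 0, snd h)) = (fst h, 0, snd h)"
        unfolding g'F using bijF by (simp add: bij_is_surj surj_f_inv_f)
      then have "hx = fst h" "s = snd h" "f' ?w (hx, k, s) = 0"
        unfolding k F'_def by auto
      then have "jacobian_xdot f ?w *v k = - deriv_xt f ?w h"
        using split[OF w, of "(hx, k, s)"] by (metis add_eq_0_iff2 fst_conv prod.collapse snd_conv)
      then have "matrix_inv (jacobian_xdot f ?w) *v (jacobian_xdot f ?w *v k)
          = matrix_inv (jacobian_xdot f ?w) *v (- deriv_xt f ?w h)"
        by simp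
      then show ?thesis
        by (simp add: k matrix_vector_mul_assoc matrix_inv_mult(1)[OF inv]
              linear_neg[OF matrix_vector_mul_linear])
    qed
    ultimately show "(\<phi> has_derivative (\<lambda>h. - (matrix_inv (jacobian_xdot f ?w) *v deriv_xt f ?w h)))
        (at (x, t))"
      by (simp add: \<phi>_def case_prod_unfold)
  qed
  ultimately have "explicit_local_rep f U z U' U2 \<phi>"
    unfolding explicit_local_rep_def using U' by blast
  then show ?thesis by blast
qed

section \<open>The indeterminates of the explicit \<open>\<sigma>\<pi>\<close>-ODE\<close>

text \<open>The component \<open>y $ i\<close> becomes the additional indeterminate \<open>Inr (numbering i)\<close>; the indeterminate
  \<open>Inr CARD('n)\<close> is reserved for the inverse of the determinant.\<close>

definition numbering :: "'n::finite \<Rightarrow> nat"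
  where "numbering = (SOME e. bij_betw e UNIV {..<CARD('n)})"

lemma bij_betw_numbering: "bij_betw (numbering :: 'n \<Rightarrow> nat) UNIV {..<CARD('n::finite)}"
  unfolding numbering_def
  using someI_ex[OF ex_bij_betw_finite_nat[OF finite, of "UNIV :: 'n set"]]
  by (simp add: lessThan_atLeast0)

lemma numbering_less [simp]: "numbering (i :: 'n::finite) < CARD('n)"
  using bij_betw_numbering by (auto dest: bij_betwE)

lemma inv_numbering [simp]: "inv numbering (numbering (i :: 'n::finite)) = i"
  using bij_betw_numbering by (metis bij_betw_imp_inj_on inv_f_f)

lemma numbering_inv: "k < CARD('n) \<Longrightarrow> numbering (inv numbering k :: 'n::finite) = k"
  using bij_betw_numbering[where 'n = 'n]
  by (metis bij_betw_def f_inv_into_f lessThan_iff)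

abbreviation ext_indets :: "('n::finite + nat) set"
  where "ext_indets \<equiv> indets (Suc CARD('n))"

definition state_x :: "('n::finite + nat \<Rightarrow> real) \<Rightarrow> real^'n"
  where "state_x X = (\<chi> i. X (Inl i))"

definition state_y :: "('n::finite + nat \<Rightarrow> real) \<Rightarrow> real^'n"
  where "state_y X = (\<chi> i. X (Inr (numbering i)))"

definition state :: "real^'n \<Rightarrow> real^'n \<Rightarrow> (nat \<Rightarrow> real) \<Rightarrow> 'n::finite + nat \<Rightarrow> real"
  where "state x y w = (\<lambda>Inl i \<Rightarrow> x $ i | Inr k \<Rightarrow> if k < CARD('n) then y $ inv numbering k else w k)"

lemma state_simps [simp]:
  "state x y w (Inl i) = x $ i"
  "state x y w (Inr (numbering i)) = y $ i"
  "state (x :: real^'n) y w (Inr CARD('n)) = w CARD('n)"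
  "state_x (state x y w) = x"
  "state_y (state x y w) = y"
  by (simp_all add: state_def state_x_def state_y_def)

lemma state_state_x_state_y: "state (state_x X) (state_y X) (\<lambda>k. X (Inr k)) = X"
  by (auto simp: fun_eq_iff state_def state_x_def state_y_def numbering_inv split: sum.split)

lemma has_derivative_state:
  fixes x y :: "'a::real_normed_vector \<Rightarrow> real^'n"
  assumes "(x has_derivative x') F" "(y has_derivative y') F"
  shows "((\<lambda>b. state (x b) (y b) w i) has_derivative (\<lambda>h. state (x' h) (y' h) (\<lambda>_. 0) i)) F"
proof (cases i)
  case (Inl j)
  then show ?thesis
    using bounded_linear.has_derivative[OF bounded_linear_vec_nth assms(1)] by (simp add: state_def)
next
  case (Inr k)
  then show ?thesis
    using bounded_linear.has_derivative[OF bounded_linear_vec_nth assms(2)]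
    by (cases "k < CARD('n)") (simp_all add: state_def)
qed

lemma finite_indets [simp]: "finite (indets d :: ('n::finite + nat) set)"
  by (simp add: indets_def)

lemma ext_indets_mem [simp]:
  "Inl i \<in> (ext_indets :: ('n::finite + nat) set)"
  "Inr (numbering (i :: 'n)) \<in> (ext_indets :: ('n + nat) set)"
  "Inr CARD('n) \<in> (ext_indets :: ('n + nat) set)"
  by (auto simp: indets_def less_SucI)

lemma ext_indets_eq:
  "(ext_indets :: ('n + nat) set) = range Inl \<union> insert (Inr CARD('n)) (range (Inr \<circ> (numbering :: 'n::finite \<Rightarrow> nat)))"
  using bij_betw_numbering[where 'n = 'n]
  by (auto simp: indets_def bij_betw_def less_Suc_eq image_iff)

lemma inj_Inr_numbering: "inj (Inr \<circ> numbering :: 'n::finite \<Rightarrow> 'a + nat)"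
  using bij_betw_imp_inj_on[OF bij_betw_numbering] by (simp add: inj_def)

lemma Inr_card_notin_range:
  "(Inr CARD('n) :: 'a + nat) \<notin> range (Inr \<circ> (numbering :: 'n::finite \<Rightarrow> nat))"
proof
  assume "(Inr CARD('n) :: 'a + nat) \<in> range (Inr \<circ> (numbering :: 'n \<Rightarrow> nat))"
  then obtain i :: 'n where "numbering i = CARD('n)" by auto
  with numbering_less[of i] show False by simp
qed

lemma prod_ext_indets:
  fixes g :: "'n::finite + nat \<Rightarrow> 'a::comm_monoid_mult"
  shows "(\<Prod>k\<in>ext_indets. g k)
    = (\<Prod>i\<in>UNIV. g (Inl i)) * ((\<Prod>i::'n\<in>UNIV. g (Inr (numbering i))) * g (Inr CARD('n)))"
  using Inr_card_notin_range[where 'n = 'n and 'a = 'n] unfolding ext_indets_eq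
  by (subst prod.union_disjoint)
    (auto simp: prod.reindex[OF inj_Inr_numbering, unfolded o_def] o_def prod.reindex mult.commute)

lemma sum_ext_indets:
  fixes g :: "'n::finite + nat \<Rightarrow> 'a::comm_monoid_add"
  shows "(\<Sum>k\<in>ext_indets. g k)
    = (\<Sum>i\<in>UNIV. g (Inl i)) + ((\<Sum>i::'n\<in>UNIV. g (Inr (numbering i))) + g (Inr CARD('n)))"
  using Inr_card_notin_range[where 'n = 'n and 'a = 'n] unfolding ext_indets_eq
  by (subst sum.union_disjoint)
    (auto simp: sum.reindex[OF inj_Inr_numbering, unfolded o_def] o_def sum.reindex add.commute)

text \<open>The indeterminate for the inverse of the determinant is not tied to the determinant here, so
  that it can be varied independently of \<open>x\<close> and \<open>y\<close>.\<close>

definition lift_domain :: "((real^'n) \<times> (real^'n) \<times> real) set \<Rightarrow> (('n::finite + nat \<Rightarrow> real) \<times> real) set"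
  where "lift_domain U = {(X, t). (state_x X, state_y X, t) \<in> U}"

lemma state_in_lift_domain [simp]: "(state x y w, t) \<in> lift_domain U \<longleftrightarrow> (x, y, t) \<in> U"
  by (simp add: lift_domain_def)

lemma choice_pair: "\<forall>x. \<exists>a b. Q x a b \<Longrightarrow> \<exists>f g. \<forall>x. Q x (f x) (g x)"
  by metis

lemma choice_triple: "\<forall>x. \<exists>a b c. Q x a b c \<Longrightarrow> \<exists>f g h. \<forall>x. Q x (f x) (g x) (h x)"
  by metis

text \<open>The components of \<open>f\<close>, regarded as functions of all indeterminates, have exponent 0 at the
  last one.\<close>

lemma analytic_sigma_pi_lift:
  fixes f :: "(real^'n) \<times> (real^'n) \<times> real \<Rightarrow> real^'n"
  assumes "analytic_sigma_pi U f"
  obtains T where "open_interval T" and "lift_domain U \<subseteq> UNIV \<times> T"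
    and "\<And>i. sigma_pi_on ext_indets T (lift_domain U) (\<lambda>X t. f (state_x X, state_y X, t) $ i)"
proof -
  obtain T and \<nu> :: "'n \<Rightarrow> nat" and v p q where T: "open_interval T"
    and v: "\<forall>i. \<forall>l<\<nu> i. real_analytic_on (v i l) T"
    and U: "\<forall>(x, y, t)\<in>U. t \<in> T \<and>
          (\<forall>i. \<forall>l<\<nu> i. \<forall>j. rpow_defined (x$j) (p i l j) \<and> rpow_defined (y$j) (q i l j)) \<and>
          (\<forall>i. f (x, y, t) $ i =
             (\<Sum>l<\<nu> i. v i l t * (\<Prod>j\<in>UNIV. rpow (x$j) (p i l j) * rpow (y$j) (q i l j))))"
    using assms unfolding analytic_sigma_pi_def by blast
  let ?P = "\<lambda>i l. state (\<chi> j. p i l j) (\<chi> j. q i l j) (\<lambda>_. 0)"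
  show thesis
  proof
    show "open_interval T" by fact
    show "lift_domain U \<subseteq> UNIV \<times> T"
      using U by (auto simp: lift_domain_def)
    fix i
    have "sigma_pi_on ext_indets T (lift_domain U)
        (\<lambda>X t. \<Sum>l<\<nu> i. v i l t * (\<Prod>j\<in>ext_indets. rpow (X j) (?P i l j)))"
    proof (intro sigma_pi_on_sum sigma_pi_on_monomial v[rule_format])
      fix l X t j assume "l \<in> {..<\<nu> i}" "(X, t) \<in> lift_domain U" "j \<in> (ext_indets :: ('n + nat) set)"
      then show "rpow_defined (X j) (?P i l j)"
        using bspec[OF U, of "(state_x X, state_y X, t)"]
        by (auto simp: lift_domain_def ext_indets_eq state_x_def state_y_def)
    qed simp
    then show "sigma_pi_on ext_indets T (lift_domain U) (\<lambda>X t. f (state_x X, state_y X, t) $ i)"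
    proof (rule sigma_pi_on_cong)
      fix X t assume "(X, t) \<in> lift_domain U"
      then show "f (state_x X, state_y X, t) $ i
          = (\<Sum>l<\<nu> i. v i l t * (\<Prod>j\<in>ext_indets. rpow (X j) (?P i l j)))"
        using bspec[OF U, of "(state_x X, state_y X, t)"]
        by (simp add: lift_domain_def prod_ext_indets prod.distrib state_x_def state_y_def)
    qed
  qed
qed

text \<open>Here \<open>A\<close>, \<open>B\<close>, \<open>C\<close> are the partial derivatives with respect to \<open>y\<close>, \<open>x\<close> and \<open>t\<close>.\<close>

lemma analytic_sigma_pi_has_derivative:
  fixes f :: "(real^'n) \<times> (real^'n) \<times> real \<Rightarrow> real^'n"
  assumes f: "analytic_sigma_pi U f"
  obtains T A B C where "open_interval T" and "lift_domain U \<subseteq> UNIV \<times> T"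
    and "\<And>i j. sigma_pi_on ext_indets T (lift_domain U) (A i j)"
    and "\<And>i j. sigma_pi_on ext_indets T (lift_domain U) (B i j)"
    and "\<And>i. sigma_pi_on ext_indets T (lift_domain U) (C i)"
    and "\<And>X t. (X, t) \<in> lift_domain U \<Longrightarrow> (f has_derivative
      (\<lambda>h. \<chi> i. (\<Sum>j\<in>UNIV. B i j X t * fst h $ j) + (\<Sum>j\<in>UNIV. A i j X t * fst (snd h) $ j)
         + C i X t * snd (snd h))) (at (state_x X, state_y X, t))"
proof -
  have "open U" using f by (simp add: analytic_sigma_pi_def)
  obtain T where T: "open_interval T" "lift_domain U \<subseteq> UNIV \<times> T"
    and fi: "\<And>i. sigma_pi_on ext_indets T (lift_domain U) (\<lambda>X t. f (state_x X, state_y X, t) $ i)"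
    using analytic_sigma_pi_lift[OF f] by blast
  have "\<forall>i. \<exists>G H. (\<forall>k. sigma_pi_on ext_indets T (lift_domain U) (G k)) \<and>
      sigma_pi_on ext_indets T (lift_domain U) H \<and>
      (\<forall>X t. (X, t) \<in> lift_domain U \<longrightarrow> ((\<lambda>b. f b $ i) has_derivative
        (\<lambda>h. (\<Sum>j\<in>UNIV. G (Inl j) X t * fst h $ j)
          + (\<Sum>j\<in>UNIV. G (Inr (numbering j)) X t * fst (snd h) $ j) + H X t * snd (snd h)))
        (at (state_x X, state_y X, t)))"
  proof
    fix i
    let ?g = "\<lambda>X t. f (state_x X, state_y X, t) $ i"
    obtain G H where G: "\<And>k. sigma_pi_on ext_indets T (lift_domain U) (G k)"
      and H: "sigma_pi_on ext_indets T (lift_domain U) H"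
      and der: "\<And>u u' \<tau> \<tau>' (a :: (real^'n) \<times> (real^'n) \<times> real).
        (\<forall>\<^sub>F b in nhds a. ((\<lambda>j. u j b), \<tau> b) \<in> lift_domain U) \<Longrightarrow>
        (\<And>j. j \<in> ext_indets \<Longrightarrow> (u j has_derivative u' j) (at a)) \<Longrightarrow>
        (\<tau> has_derivative \<tau>') (at a) \<Longrightarrow>
        ((\<lambda>b. ?g (\<lambda>j. u j b) (\<tau> b)) has_derivative
          (\<lambda>h. (\<Sum>k\<in>ext_indets. G k (\<lambda>j. u j a) (\<tau> a) * u' k h) + H (\<lambda>j. u j a) (\<tau> a) * \<tau>' h)) (at a)"
      using sigma_pi_on_has_derivative[OF fi finite_indets T(2)] by blast
    have "((\<lambda>b. f b $ i) has_derivative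
        (\<lambda>h. (\<Sum>j\<in>UNIV. G (Inl j) X t * fst h $ j)
          + (\<Sum>j\<in>UNIV. G (Inr (numbering j)) X t * fst (snd h) $ j) + H X t * snd (snd h)))
        (at (state_x X, state_y X, t))" if Xt: "(X, t) \<in> lift_domain U" for X t
    proof -
      let ?a = "(state_x X, state_y X, t)"
      let ?u = "\<lambda>j b. state (fst b) (fst (snd b)) (\<lambda>k. X (Inr k)) j"
      let ?u' = "\<lambda>j h. state (fst h) (fst (snd h)) (\<lambda>k. 0) j"
      have "\<forall>\<^sub>F b in nhds ?a. b \<in> U"
        using \<open>open U\<close> Xt by (intro eventually_nhds_in_open) (auto simp: lift_domain_def)
      then have "\<forall>\<^sub>F b in nhds ?a. ((\<lambda>j. ?u j b), snd (snd b)) \<in> lift_domain U"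
        by eventually_elim simp
      moreover have "(?u j has_derivative ?u' j) (at ?a)" for j
        by (intro has_derivative_state) (auto intro!: derivative_eq_intros)
      moreover have "((\<lambda>b. snd (snd b)) has_derivative (\<lambda>h. snd (snd h))) (at ?a)"
        by (auto intro!: derivative_eq_intros)
      ultimately show ?thesis
         using der[of ?u "\<lambda>b. snd (snd b)" ?a ?u' "\<lambda>h. snd (snd h)"]
        by (simp add: sum_ext_indets state_state_x_state_y add.assoc)
    qed
    with G H show "\<exists>G H. (\<forall>k. sigma_pi_on ext_indets T (lift_domain U) (G k)) \<and>
      sigma_pi_on ext_indets T (lift_domain U) H \<and>
      (\<forall>X t. (X, t) \<in> lift_domain U \<longrightarrow> ((\<lambda>b. f b $ i) has_derivative
        (\<lambda>h. (\<Sum>j\<in>UNIV. G (Inl j) X t * fst h $ j)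
          + (\<Sum>j\<in>UNIV. G (Inr (numbering j)) X t * fst (snd h) $ j) + H X t * snd (snd h)))
        (at (state_x X, state_y X, t)))"
      by blast
  qed
  from choice_pair[OF this] obtain G H where G: "\<And>i k. sigma_pi_on ext_indets T (lift_domain U) (G i k)"
    and H: "\<And>i. sigma_pi_on ext_indets T (lift_domain U) (H i)"
    and der: "\<And>i X t. (X, t) \<in> lift_domain U \<Longrightarrow> ((\<lambda>b. f b $ i) has_derivative
        (\<lambda>h. (\<Sum>j\<in>UNIV. G i (Inl j) X t * fst h $ j)
          + (\<Sum>j\<in>UNIV. G i (Inr (numbering j)) X t * fst (snd h) $ j) + H i X t * snd (snd h)))
        (at (state_x X, state_y X, t))"
    by blast
  show thesis
  proof
    fix X t assume "(X, t) \<in> lift_domain U"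
    then show "(f has_derivative
      (\<lambda>h. \<chi> i. (\<Sum>j\<in>UNIV. G i (Inl j) X t * fst h $ j)
         + (\<Sum>j\<in>UNIV. G i (Inr (numbering j)) X t * fst (snd h) $ j) + H i X t * snd (snd h)))
      (at (state_x X, state_y X, t))"
      by (subst has_derivative_componentwise_within)
        (auto simp: Basis_vec_def inner_axis intro!: der)
  qed (rule T G H)+
qed

section \<open>Reduction to an explicit \<open>\<sigma>\<pi>\<close>-ODE\<close>

text \<open>A \<open>\<sigma>\<pi>\<close>-function is differentiable, hence continuous.  Applied to the partial derivatives of \<open>f\<close>
  this supplies the continuous differentiability that the inverse function theorem requires.\<close>

lemma continuous_on_sigma_pi_state:
  fixes U :: "((real^'n) \<times> (real^'n) \<times> real) set"
  assumes g: "sigma_pi_on ext_indets T (lift_domain U) g" and T: "lift_domain U \<subseteq> UNIV \<times> T"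
    and U: "open U"
  shows "continuous_on U (\<lambda>w. g (state (fst w) (fst (snd w)) (\<lambda>_. 0)) (snd (snd w)))"
proof -
  obtain G H where "\<And>k. sigma_pi_on ext_indets T (lift_domain U) (G k)"
    and "sigma_pi_on ext_indets T (lift_domain U) H"
    and der: "\<And>u u' \<tau> \<tau>' (a :: (real^'n) \<times> (real^'n) \<times> real).
      (\<forall>\<^sub>F b in nhds a. ((\<lambda>j. u j b), \<tau> b) \<in> lift_domain U) \<Longrightarrow>
      (\<And>j. j \<in> ext_indets \<Longrightarrow> (u j has_derivative u' j) (at a)) \<Longrightarrow>
      (\<tau> has_derivative \<tau>') (at a) \<Longrightarrow>
      ((\<lambda>b. g (\<lambda>j. u j b) (\<tau> b)) has_derivative
        (\<lambda>h. (\<Sum>k\<in>ext_indets. G k (\<lambda>j. u j a) (\<tau> a) * u' k h) + H (\<lambda>j. u j a) (\<tau> a) * \<tau>' h)) (at a)"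
    using sigma_pi_on_has_derivative[OF g finite_indets T] by blast
  have "isCont (\<lambda>w. g (state (fst w) (fst (snd w)) (\<lambda>_. 0)) (snd (snd w))) w" if "w \<in> U" for w
  proof -
    let ?u = "\<lambda>j b. state (fst b) (fst (snd b)) (\<lambda>_. 0) j"
    have "\<forall>\<^sub>F b in nhds w. b \<in> U"
      using U that by (rule eventually_nhds_in_open)
    then have "\<forall>\<^sub>F b in nhds w. ((\<lambda>j. ?u j b), snd (snd b)) \<in> lift_domain U"
      by eventually_elim simp
    moreover have "(?u j has_derivative ?u j) (at w)" for j
      by (intro has_derivative_state) (auto intro!: derivative_eq_intros)
    moreover have "((\<lambda>b. snd (snd b)) has_derivative (\<lambda>h. snd (snd h))) (at w)"
      by (auto intro!: derivative_eq_intros)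
    ultimately show ?thesis
      by (intro has_derivative_continuous[OF der[of ?u "\<lambda>b. snd (snd b)" w ?u "\<lambda>h. snd (snd h)"]])
  qed
  then show ?thesis
    by (simp add: continuous_at_imp_continuous_on)
qed

lemma analytic_sigma_pi_explicit_local_rep_exists:
  fixes f :: "(real^'n) \<times> (real^'n) \<times> real \<Rightarrow> real^'n"
  assumes f: "analytic_sigma_pi U f" and z: "z \<in> U" "f z = 0" and inv: "invertible (jacobian_xdot f z)"
  shows "\<exists>U\<^sub>1 U\<^sub>2 \<phi>. explicit_local_rep f U z U\<^sub>1 U\<^sub>2 \<phi>"
proof -
  have U: "open U" using f by (simp add: analytic_sigma_pi_def)
  obtain T A B C where "open_interval T" and T: "lift_domain U \<subseteq> UNIV \<times> T"
    and sp: "\<And>i j. sigma_pi_on ext_indets T (lift_domain U) (A i j)"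
      "\<And>i j. sigma_pi_on ext_indets T (lift_domain U) (B i j)"
      "\<And>i. sigma_pi_on ext_indets T (lift_domain U) (C i)"
    and der: "\<And>X t. (X, t) \<in> lift_domain U \<Longrightarrow> (f has_derivative
      (\<lambda>h. \<chi> i. (\<Sum>j\<in>UNIV. B i j X t * fst h $ j) + (\<Sum>j\<in>UNIV. A i j X t * fst (snd h) $ j)
         + C i X t * snd (snd h))) (at (state_x X, state_y X, t))"
    using analytic_sigma_pi_has_derivative[OF f] by blast
  let ?X = "\<lambda>w. state (fst w) (fst (snd w)) (\<lambda>_. 0)" and ?t = "\<lambda>w. snd (snd w)"
  let ?f' = "\<lambda>w h. \<chi> i. (\<Sum>j\<in>UNIV. B i j (?X w) (?t w) * fst h $ j)
    + (\<Sum>j\<in>UNIV. A i j (?X w) (?t w) * fst (snd h) $ j) + C i (?X w) (?t w) * snd (snd h)"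
  show ?thesis
  proof (rule explicit_local_rep_exists[OF U _ _ z inv])
    show "(f has_derivative ?f' w) (at w)" if "w \<in> U" for w
      using der[of "?X w" "?t w"] that by simp
    show "continuous_on U (\<lambda>w. ?f' w h)" for h
      by (intro continuous_on_vec_lambda continuous_intros continuous_on_sigma_pi_state[OF _ T U] sp)
  qed
qed

text \<open>The right-hand sides are \<open>y\<close> for \<open>x\<close>, Cramer's quotients \<open>Ry\<close> for \<open>y\<close>, with the division replaced
  by multiplication with \<open>w\<close>, and \<open>Rw\<close> for \<open>w = 1 / det A\<close>.\<close>

lemma sigma_pi_reducible_of_explicit_local_rep:
  fixes f :: "(real^'n) \<times> (real^'n) \<times> real \<Rightarrow> real^'n"
  assumes f: "analytic_sigma_pi U f" and rep: "explicit_local_rep f U z U\<^sub>1 U\<^sub>2 \<phi>"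
  shows "sigma_pi_reducible \<phi> U\<^sub>2"
proof -
  let ?n = "CARD('n)" and ?D = "lift_domain U" and ?I = "ext_indets :: ('n + nat) set"
  obtain T A B C where T: "open_interval T" "?D \<subseteq> UNIV \<times> T"
    and A: "\<And>i j. sigma_pi_on ?I T ?D (A i j)"
    and B: "\<And>i j. sigma_pi_on ?I T ?D (B i j)"
    and C: "\<And>i. sigma_pi_on ?I T ?D (C i)"
    and der: "\<And>X t. (X, t) \<in> ?D \<Longrightarrow> (f has_derivative
      (\<lambda>h. \<chi> i. (\<Sum>j\<in>UNIV. B i j X t * fst h $ j) + (\<Sum>j\<in>UNIV. A i j X t * fst (snd h) $ j)
         + C i X t * snd (snd h))) (at (state_x X, state_y X, t))"
    using analytic_sigma_pi_has_derivative[OF f] by blast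
  have jac: "jacobian_xdot f (state_x X, state_y X, t) = (\<chi> i j. A i j X t)"
    and dxt: "deriv_xt f (state_x X, state_y X, t) (hx, s)
      = (\<chi> i. (\<Sum>j\<in>UNIV. B i j X t * hx $ j) + C i X t * s)"
    if "(X, t) \<in> ?D" for X t hx s
  proof -
    note split = jacobian_deriv_xt_split[OF der[OF that]]
    have deriv_0: "deriv_xt f (state_x X, state_y X, t) (0, 0) = 0"
      using split[of 0 0 0] by (simp add: vec_eq_iff)
    show "jacobian_xdot f (state_x X, state_y X, t) = (\<chi> i j. A i j X t)"
      unfolding matrix_eq
      using split[of 0 _ 0] deriv_0 by (simp add: matrix_vector_mult_def)
    show "deriv_xt f (state_x X, state_y X, t) (hx, s)
      = (\<chi> i. (\<Sum>j\<in>UNIV. B i j X t * hx $ j) + C i X t * s)"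
      using split[of hx 0 s] by simp
  qed
  \<comment> \<open>By \<open>jac\<close>, \<open>\<Delta>\<close> does not depend on the last indeterminate on the domain.\<close>
  define \<Delta> where "\<Delta> = (\<lambda>X t. det (\<chi> i j. A i j X t))"
  have \<Delta>: "sigma_pi_on ?I T ?D \<Delta>"
    unfolding \<Delta>_def by (intro sigma_pi_on_det A)
  obtain G H where G: "\<And>k. sigma_pi_on ?I T ?D (G k)" and H: "sigma_pi_on ?I T ?D H"
    and \<Delta>_der: "\<And>u u' \<tau> \<tau>' (a::real).
      (\<forall>\<^sub>F b in nhds a. ((\<lambda>j. u j b), \<tau> b) \<in> ?D) \<Longrightarrow>
      (\<And>j. j \<in> ?I \<Longrightarrow> (u j has_derivative u' j) (at a)) \<Longrightarrow> (\<tau> has_derivative \<tau>') (at a) \<Longrightarrow>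
      ((\<lambda>b. \<Delta> (\<lambda>j. u j b) (\<tau> b)) has_derivative
        (\<lambda>h. (\<Sum>k\<in>?I. G k (\<lambda>j. u j a) (\<tau> a) * u' k h) + H (\<lambda>j. u j a) (\<tau> a) * \<tau>' h)) (at a)"
    using sigma_pi_on_has_derivative[OF \<Delta> finite_indets T(2)] by blast
  \<comment> \<open>The right-hand side of the linear system for the derivative of \<open>y\<close>.\<close>
  define b where "b = (\<lambda>i X t. - ((\<Sum>j\<in>UNIV. B i j X t * X (Inr (numbering j))) + C i X t))"
  define Ry where "Ry = (\<lambda>k X t. X (Inr ?n) * det (\<chi> i j. if j = k then b i X t else A i j X t))"
  \<comment> \<open>\<open>- w\<^sup>2 (d/dt) \<Delta>\<close>, without a contribution from the partial derivative of \<open>\<Delta>\<close> with respect to \<open>w\<close>.\<close>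
  define Rw where "Rw = (\<lambda>X t. - (X (Inr ?n) * X (Inr ?n) *
    ((\<Sum>i\<in>UNIV. G (Inl i) X t * X (Inr (numbering i)))
      + (\<Sum>i\<in>UNIV. G (Inr (numbering i)) X t * Ry i X t) + H X t)))"
  define R :: "'n + nat \<Rightarrow> ('n + nat \<Rightarrow> real) \<Rightarrow> real \<Rightarrow> real"
    where "R = (\<lambda>Inl i \<Rightarrow> \<lambda>X t. X (Inr (numbering i))
    | Inr k \<Rightarrow> if k < ?n then Ry (inv numbering k) else Rw)"
  have R_simps: "R (Inl i) X t = X (Inr (numbering i))" "R (Inr (numbering i)) = Ry i" "R (Inr ?n) = Rw"
    for i :: 'n and X t
    by (simp_all add: R_def)
  have ind: "sigma_pi_on ?I T ?D (\<lambda>X t. X i)" if "i \<in> ?I" for i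
    using that by (intro sigma_pi_on_indeterminate finite_indets)
  have b: "sigma_pi_on ?I T ?D (b i)" for i
    unfolding b_def
    by (intro sigma_pi_on_uminus sigma_pi_on_add sigma_pi_on_sum sigma_pi_on_mult B C ind) simp
  have Ry: "sigma_pi_on ?I T ?D (Ry k)" for k
  proof -
    have "sigma_pi_on ?I T ?D (\<lambda>X t. X (Inr ?n) * det (\<chi> i j. (if j = k then b i else A i j) X t))"
      by (intro sigma_pi_on_mult sigma_pi_on_det ind) (auto intro: b A)
    then show ?thesis
      unfolding Ry_def by (simp add: if_distribR cong: if_cong)
  qed
  have Rw: "sigma_pi_on ?I T ?D Rw"
    unfolding Rw_def
    by (intro sigma_pi_on_uminus sigma_pi_on_add sigma_pi_on_sum sigma_pi_on_mult G H Ry ind) simp_all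
  have "\<forall>i. sigma_pi_on ?I T ?D (R i)"
    by (auto simp: R_def intro: Ry Rw ind split: sum.split)
  from choice_triple[OF this[unfolded sigma_pi_on_def]] obtain N :: "'n + nat \<Rightarrow> nat" and v p where v: "\<And>i l. l < N i \<Longrightarrow> real_analytic_on (v i l) T"
    and p: "\<And>X t i l j. (X, t) \<in> ?D \<Longrightarrow> l < N i \<Longrightarrow> j \<in> ?I \<Longrightarrow> rpow_defined (X j) (p i l j)"
    and R: "\<And>X t i. (X, t) \<in> ?D \<Longrightarrow> R i X t = (\<Sum>l<N i. v i l t * (\<Prod>j\<in>?I. rpow (X j) (p i l j)))"
    by blast
  have sol: "\<exists>X. sigma_pi_solution (Suc ?n) T N v p J X \<and> (\<forall>t\<in>J. \<forall>i. X (Inl i) t = x t $ i)"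
    if x: "explicit_solution \<phi> U\<^sub>2 J x" for J x
  proof -
    have J: "open_interval J" and xU: "\<And>t. t \<in> J \<Longrightarrow> (x t, t) \<in> U\<^sub>2"
      and x': "\<And>t. t \<in> J \<Longrightarrow> (x has_vector_derivative \<phi> (x t, t)) (at t)"
      using x by (auto simp: explicit_solution_def)
    define y where "y = (\<lambda>t. \<phi> (x t, t))"
    define \<delta> where "\<delta> = (\<lambda>t. det (jacobian_xdot f (x t, y t, t)))"
    define X where "X = (\<lambda>i t. state (x t) (y t) (\<lambda>_. 1 / \<delta> t) i)"
    have inU: "(x t, y t, t) \<in> U" if "t \<in> J" for t
    proof -
      have "(x t, y t, t) \<in> {(x, \<phi> (x, t), t) | x t. (x, t) \<in> U\<^sub>2}"
        using xU[OF that] by (auto simp: y_def)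
      then show ?thesis
        using rep by (auto simp: explicit_local_rep_def)
    qed
    have \<Delta>_eq: "\<Delta> (state (x t) (y t) w) t = \<delta> t" if "t \<in> J" for t w
      using jac[of "state (x t) (y t) w" t] inU[OF that] by (simp add: \<Delta>_def \<delta>_def)
    have solves: "((\<lambda>t. X i t) has_real_derivative R i (\<lambda>j. X j t) t) (at t)"
      if t: "t \<in> J" and i: "i \<in> ?I" for i t
    proof -
      let ?X = "\<lambda>j. X j t" and ?J = "jacobian_xdot f (x t, y t, t)"
      have XD: "(?X, t) \<in> ?D"
        using inU[OF t] by (simp add: X_def)
      have [simp]: "state_x ?X = x t" "state_y ?X = y t"
        by (simp_all add: X_def)
      have inv: "invertible ?J" and \<phi>: "(\<phi> has_derivative
          (\<lambda>h. - (matrix_inv ?J *v deriv_xt f (x t, y t, t) h))) (at (x t, t))"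
        using rep xU[OF t] by (auto simp: explicit_local_rep_def y_def)
      have \<delta>_nz: "\<delta> t \<noteq> 0"
        using inv by (simp add: \<delta>_def invertible_det_nz)
      have X_simps: "?X (Inr (numbering i)) = y t $ i" "?X (Inr ?n) = 1 / \<delta> t" for i :: 'n
        by (simp_all add: X_def)
      have x_t: "(x has_derivative (\<lambda>h. h *\<^sub>R y t)) (at t)"
        using x'[OF t] by (simp add: has_vector_derivative_def y_def)
      define y' where "y' = - (matrix_inv ?J *v deriv_xt f (x t, y t, t) (y t, 1))"
      have y_t: "(y has_derivative (\<lambda>h. h *\<^sub>R y')) (at t)"
      proof -
        have "((\<lambda>s. (x s, s)) has_derivative (\<lambda>h. (h *\<^sub>R y t, h))) (at t)"
          by (intro has_derivative_Pair x_t has_derivative_ident)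
        from has_derivative_compose[OF this \<phi>]
        have y: "(y has_derivative
            (\<lambda>h. - (matrix_inv ?J *v deriv_xt f (x t, y t, t) (h *\<^sub>R y t, h)))) (at t)"
          by (simp add: y_def)
        from linear_cmul[OF has_derivative_linear[OF this], of _ 1]
        have "- (matrix_inv ?J *v deriv_xt f (x t, y t, t) (h *\<^sub>R y t, h)) = h *\<^sub>R y'" for h
          by (simp add: y'_def)
        with y show ?thesis by simp
      qed
      have "?J *v y' = - deriv_xt f (x t, y t, t) (y t, 1)"
        by (simp add: y'_def linear_neg[OF matrix_vector_mul_linear] matrix_vector_mul_assoc
            matrix_inv_mult(2)[OF inv])
      also have "\<dots> = (\<chi> i. b i ?X t)"
        using dxt[OF XD, of "y t" 1] by (simp add: b_def X_simps vec_eq_iff)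
      finally have "y' = (\<chi> k. det (\<chi> i j. if j = k then b i ?X t else ?J $ i $ j) / det ?J)"
        using cramer[of ?J y' "\<chi> i. b i ?X t"] inv by (simp add: invertible_det_nz cong: if_cong)
      then have y'_Ry: "y' $ k = Ry k ?X t" for k
        using jac[OF XD] by (simp add: Ry_def X_simps \<delta>_def cong: if_cong)
      have \<delta>_t: "(\<delta> has_derivative (\<lambda>h. h * ((\<Sum>i\<in>UNIV. G (Inl i) ?X t * y t $ i)
          + (\<Sum>i\<in>UNIV. G (Inr (numbering i)) ?X t * Ry i ?X t) + H ?X t))) (at t)"
      proof -
        \<comment> \<open>The last indeterminate is frozen at its value at time \<open>t\<close>.  On the domain this does not
          change \<open>\<Delta>\<close>, and it removes the derivative of \<open>w\<close>, which is not yet known, from the chain rule.\<close>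
        let ?u = "\<lambda>j s. state (x s) (y s) (\<lambda>_. 1 / \<delta> t) j"
        have u_t: "state (x t) (y t) (\<lambda>_. 1 / \<delta> t) = ?X"
          by (simp add: X_def)
        let ?u' = "\<lambda>j h. state (h *\<^sub>R y t) (h *\<^sub>R y') (\<lambda>_. 0) j"
        have evJ: "\<forall>\<^sub>F s in nhds t. s \<in> J"
          using J t by (intro eventually_nhds_in_open) (auto simp: open_interval_def)
        then have "\<forall>\<^sub>F s in nhds t. ((\<lambda>j. ?u j s), s) \<in> ?D"
          by eventually_elim (simp add: inU)
        moreover have "(?u j has_derivative ?u' j) (at t)" for j
          by (intro has_derivative_state x_t y_t)
        ultimately have "((\<lambda>s. \<Delta> (\<lambda>j. ?u j s) s) has_derivative
            (\<lambda>h. (\<Sum>k\<in>?I. G k (\<lambda>j. ?u j t) t * ?u' k h) + H (\<lambda>j. ?u j t) t * h)) (at t)"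
          using \<Delta>_der[of ?u "\<lambda>s. s" t ?u' "\<lambda>h. h"] has_derivative_ident by blast
        also have "(\<lambda>h. (\<Sum>k\<in>?I. G k (\<lambda>j. ?u j t) t * ?u' k h) + H (\<lambda>j. ?u j t) t * h)
            = (\<lambda>h. h * ((\<Sum>i\<in>UNIV. G (Inl i) ?X t * y t $ i)
          + (\<Sum>i\<in>UNIV. G (Inr (numbering i)) ?X t * Ry i ?X t) + H ?X t))"
          by (simp add: sum_ext_indets u_t y'_Ry sum_distrib_left algebra_simps)
        finally show ?thesis
        proof (rule has_derivative_transform_eventually)
          show "\<forall>\<^sub>F s in at t. \<Delta> (\<lambda>j. ?u j s) s = \<delta> s"
            using evJ unfolding eventually_at_filter by eventually_elim (simp add: \<Delta>_eq)
        qed (simp_all add: \<Delta>_eq t)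
      qed
      consider (Inl) k where "i = Inl k" | (Inr) k :: 'n where "i = Inr (numbering k)" | (w) "i = Inr ?n"
        using i unfolding ext_indets_eq by auto
      then show ?thesis
      proof cases
        case (Inl k)
        then show ?thesis
          using bounded_linear.has_derivative[OF bounded_linear_vec_nth x_t, of k]
          by (simp add: R_simps X_def has_field_derivative_def mult_commute_abs)
      next
        case (Inr k)
        then show ?thesis
          using bounded_linear.has_derivative[OF bounded_linear_vec_nth y_t, of k]
          unfolding Inr R_simps y'_Ry[symmetric]
          by (simp add: X_def has_field_derivative_def mult_commute_abs)
      next
        case w
        have "(\<delta> has_real_derivative ((\<Sum>i\<in>UNIV. G (Inl i) ?X t * y t $ i)
          + (\<Sum>i\<in>UNIV. G (Inr (numbering i)) ?X t * Ry i ?X t) + H ?X t)) (at t)"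
          using \<delta>_t by (simp add: has_field_derivative_def mult_commute_abs)
        from DERIV_inverse'[OF this \<delta>_nz] show ?thesis
          unfolding w R_simps Rw_def X_simps by (simp add: X_def inverse_eq_divide mult_ac)
      qed
    qed
    have "sigma_pi_solution (Suc ?n) T N v p J X"
      unfolding sigma_pi_solution_def
    proof (intro conjI ballI J)
      show "J \<subseteq> T"
        using inU T(2) state_in_lift_domain[of _ _ "\<lambda>_. 0"] by blast
      fix t i assume t: "t \<in> J" and i: "i \<in> ?I"
      have XD: "((\<lambda>j. X j t), t) \<in> ?D"
        using inU[OF t] by (simp add: X_def)
      show "\<forall>l<N i. \<forall>j\<in>?I. rpow_defined (X j t) (p i l j)"
        using p[OF XD] by blast
      show "(X i has_real_derivative (\<Sum>l<N i. v i l t * (\<Prod>j\<in>?I. rpow (X j t) (p i l j)))) (at t)"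
        using solves[OF t i] R[OF XD] by simp
    qed
    moreover have "\<forall>t\<in>J. \<forall>i. X (Inl i) t = x t $ i"
      by (simp add: X_def)
    ultimately show ?thesis by blast
  qed
  show ?thesis
    unfolding sigma_pi_reducible_def
  proof (rule exI[of _ "Suc ?n"], rule exI[of _ T], rule exI[of _ N], rule exI[of _ v], rule exI[of _ p],
      intro conjI allI ballI impI)
    show "open_interval T" by fact
    show "real_analytic_on (v i l) T" if "l < N i" for i l
      using v that .
    fix J x assume "explicit_solution \<phi> U\<^sub>2 J x"
    from sol[OF this] obtain X where "sigma_pi_solution (Suc ?n) T N v p J X"
      and "\<forall>t\<in>J. \<forall>i. X (Inl i) t = x t $ i" by blast
    then show "\<exists>J' X. J' \<subseteq> J \<and> sigma_pi_solution (Suc ?n) T N v p J' X \<and>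
        (\<forall>t\<in>J'. \<forall>i. X (Inl i) t = x t $ i)"
      by (intro exI[of _ J] exI[of _ X]) simp
  qed
qed

theorem theorem2p13:
  fixes f :: "(real^'n) \<times> (real^'n) \<times> real \<Rightarrow> real^'n"
    and U :: "((real^'n) \<times> (real^'n) \<times> real) set"
    and z :: "(real^'n) \<times> (real^'n) \<times> real"
  assumes "analytic_sigma_pi U f"
    and "z \<in> {w \<in> U. f w = 0}"
    and "rank (jacobian_xdot f z) = CARD('n)"
  shows "(\<exists>U\<^sub>1 U\<^sub>2 \<phi>. explicit_local_rep f U z U\<^sub>1 U\<^sub>2 \<phi>) \<and>
    (\<forall>U\<^sub>1 U\<^sub>2 \<phi>. explicit_local_rep f U z U\<^sub>1 U\<^sub>2 \<phi> \<longrightarrow> sigma_pi_reducible \<phi> U\<^sub>2)"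
proof
  have "invertible (jacobian_xdot f z)"
    using assms(3) by (simp add: full_rank_injective invertible_left_inverse matrix_left_invertible_injective)
  then show "\<exists>U\<^sub>1 U\<^sub>2 \<phi>. explicit_local_rep f U z U\<^sub>1 U\<^sub>2 \<phi>"
    using assms(1,2) by (intro analytic_sigma_pi_explicit_local_rep_exists) auto
  show "\<forall>U\<^sub>1 U\<^sub>2 \<phi>. explicit_local_rep f U z U\<^sub>1 U\<^sub>2 \<phi> \<longrightarrow> sigma_pi_reducible \<phi> U\<^sub>2"
    using sigma_pi_reducible_of_explicit_local_rep[OF assms(1)] by blast
qed

end
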